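(* Let $K$ be a knot and let $A$ be an $N\times N$ triangular matrix of type I equivalent to a colouring matrix of $K$. Let $n$ be a positive integer and $m$ an integer with $\gcd(m,n)=1$, and let $Q=\mathbb{Z}_n[T,T^{-1}]/(T-m)$ be the corresponding linear finite Alexander quandle. Then the number $C_Q(K)$ of colourings of $K$ using $Q$ is $$C_Q(K)=n\times\gcd(\mathrm{Alex}_K(m),n),$$ where $\mathrm{Alex}_K$ is the Alexander polynomial of $K$.
   Context: **Linear finite Alexander quandle.** For coprime integers $n\ge 1$ and $m$, the quandle $Q=\mathbb{Z}_n[T,T^{-1}]/(T-m)$ is identified with $\mathbb{Z}_n$, with operations $a\ast b=ma+(1-m)b$ and $a\ast' b=m^{-1}a+(1-m^{-1})b$ modulo $n$. **Colourings.** Let $D$ be an oriented diagram of a knot $K$ with $N\ge1$ crossings, hence $N$ arcs. A colouring of $D$ by $Q$ assigns $X_k\in Q$ to each arc $k$ so that at each crossing with incoming under-arc $i$, outgoing under-arc $i'$ and over-arc $j$: $X_{i'}=X_i\ast X_j$ if the crossing is positive (right-handed), $X_{i'}=X_i\ast' X_j$ if it is negative (left-handed). $C_Q(K)$ is the number of colourings; it does not depend on the diagram of $K$. **Colouring matrix.** The $N\times N$ matrix over $\mathbb{Z}[m,m^{-1}]$ ($m$ regarded as an indeterminate), one row per crossing, encoding $mX_i+(1-m)X_j-X_{i'}=0$ (positive crossing) or $m^{-1}X_i+(1-m^{-1})X_j-X_{i'}=0$ (negative crossing); if some of $i,i',j$ coincide the corresponding entries are added. The entries in each row add up to zero. The colourings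 by $Q$ are the solutions in $\mathbb{Z}_n$ of $AX=0$ after evaluating at the integer $m$ modulo $n$. **Equivalent matrices.** $B$ is equivalent to a colouring matrix $A$ if it is obtained from $A$ by finitely many operations of the following kinds: (a) multiplying a row by $m$, $m^{-1}$ or $-1$; (b) replacing a row by its sum with another row; (c) swapping two rows; (d) swapping two columns. **Type I.** An $N\times N$ matrix is of type I if it is upper triangular with diagonal $(1,\dots,1,\alpha(m),0)$, its row $N-1$ is $(0,\dots,0,\alpha(m),-\alpha(m))$, and its last row is zero (other above-diagonal entries arbitrary). **Alexander polynomial.** $\mathrm{Alex}_K$ is the determinant of the matrix obtained from a colouring matrix by deleting the last row and column; it is defined up to multiplication by $\pm m^k$. Since $m$ is invertible modulo $n$, $\gcd(\mathrm{Alex}_K(m),n)$ does not depend on the representative. *)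

theory Defs
  imports
    "Jordan_Normal_Form.Determinant"
    "Jordan_Normal_Form.Column_Operations"
    "HOL-Library.FuncSet"
    "HOL-Library.Poly_Mapping"
    "HOL-Combinatorics.Orbits"
    "HOL-Number_Theory.Modular_Inverse"
begin

section \<open>Oriented knot diagrams\<close>

text \<open>
  An oriented diagram is given by its signed Gauss code: walking once along the knot in the
  direction of its orientation, one lists the passages through the crossings, each with its level
  (over or under), the name of the crossing and the sign of the crossing. The code is read
  cyclically. The empty code is the diagram of the unknot without crossings.
\<close>

datatype level = Over | Under

datatype crossing_sign = Pos | Neg

datatype passage = Pass (level: level) (crossing: nat) (csign: crossing_sign)

type_synonym gauss_code = "passage list"

fun other_level :: "level \<Rightarrow> level" where
  "other_level Over = Under"
| "other_level Under = Over"

fun opposite :: "crossing_sign \<Rightarrow> crossing_sign" where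
  "opposite Pos = Neg"
| "opposite Neg = Pos"

definition crossings :: "gauss_code \<Rightarrow> nat set" where
  "crossings w = crossing ` set w"

definition well_formed :: "gauss_code \<Rightarrow> bool" where
  "well_formed w \<longleftrightarrow>
     distinct (map (\<lambda>p. (level p, crossing p)) w) \<and>
     (\<forall>l c s. Pass l c s \<in> set w \<longrightarrow> Pass (other_level l) c s \<in> set w)"

definition passage_index :: "gauss_code \<Rightarrow> level \<Rightarrow> nat \<Rightarrow> nat" where
  "passage_index w l c = (THE i. i < length w \<and> level (w ! i) = l \<and> crossing (w ! i) = c)"

definition positive_crossing :: "gauss_code \<Rightarrow> nat \<Rightarrow> bool" where
  "positive_crossing w c \<longleftrightarrow> Pass Over c Pos \<in> set w"

text \<open>
  A well-formed code determines a cellular embedding of the underlying 4-valent graph into a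
  closed oriented surface; it comes from a diagram in the plane (equivalently, on the sphere) iff
  this surface is a sphere. Edge \<open>i\<close> of the graph leads from passage \<open>i\<close> to the cyclically next
  passage, and the dart \<open>(i, True)\<close> (or \<open>(i, False)\<close>) is this edge traversed along (or against) the
  orientation of the knot. Faces are traced by turning left at every crossing. At a positive
  crossing the under-strand runs from right to left as seen from the over-strand, and the
  over-strand runs from left to right as seen from the under-strand; at a negative crossing both
  are reversed. With \<open>N\<close> crossings there are \<open>2 * N\<close> edges, so the Euler characteristic is 2 iff
  there are \<open>N + 2\<close> faces.
\<close>

fun left_turn :: "gauss_code \<Rightarrow> nat \<times> bool \<Rightarrow> nat \<times> bool" where
  "left_turn w (i, fwd) =
     (let L = length w;
          p = w ! (if fwd then (i + 1) mod L else i);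
          k = passage_index w (other_level (level p)) (crossing p)
      in if fwd \<longleftrightarrow> (level p = Over \<longleftrightarrow> csign p = Pos) then (k, True)
         else ((k + L - 1) mod L, False))"

definition faces :: "gauss_code \<Rightarrow> (nat \<times> bool) set set" where
  "faces w = orbit (left_turn w) ` ({..<length w} \<times> UNIV)"

definition knot_diagram :: "gauss_code \<Rightarrow> bool" where
  "knot_diagram w \<longleftrightarrow>
     well_formed w \<and> (w = [] \<or> card (faces w) = card (crossings w) + 2)"


section \<open>Knots\<close>

text \<open>
  Oriented knots are the classes of diagrams modulo Reidemeister moves (and modulo the choice of
  the starting point of the code and of the names of the crossings).

  Since moves are only used between knot diagrams, the names of the crossings created by
  \<open>R1\<close> and \<open>R2\<close> are automatically new.

  In \<open>R3\<close>, the top strand meets the middle and the bottom strand in \<open>a\<close> and \<open>b\<close>, and the middle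
  strand meets the bottom strand in \<open>c\<close>; the move reverses the order of the two crossings on each
  of the three strands. The flags \<open>x\<close>, \<open>y\<close>, \<open>z\<close> say in which order each strand meets its two
  crossings. If \<open>t\<close>, \<open>u\<close>, \<open>v\<close> are the directions of the top, middle and bottom strand, closing
  up the triangle gives \<open>x * t + y * v + z * u = 0\<close> after scaling the directions by positive factors
  and reading flags as signs. The signs of \<open>a\<close>, \<open>b\<close>, \<open>c\<close> are those of \<open>det(t,u)\<close>, \<open>det(t,v)\<close>,
  \<open>det(u,v)\<close>, so taking determinants with \<open>t\<close> and \<open>v\<close> yields the two conditions of
  \<open>triangle\<close>.
\<close>

definition orient :: "bool \<Rightarrow> 'a list \<Rightarrow> 'a list" where
  "orient b xs = (if b then xs else rev xs)"

definition triangle ::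
    "bool \<Rightarrow> bool \<Rightarrow> bool \<Rightarrow> crossing_sign \<Rightarrow> crossing_sign \<Rightarrow> crossing_sign \<Rightarrow> bool" where
  "triangle x y z sa sb sc \<longleftrightarrow> (y = z \<longleftrightarrow> sa \<noteq> sb) \<and> (x = z \<longleftrightarrow> sb \<noteq> sc)"

fun rename :: "(nat \<Rightarrow> nat) \<Rightarrow> passage \<Rightarrow> passage" where
  "rename f (Pass l c s) = Pass l (f c) s"

inductive move :: "gauss_code \<Rightarrow> gauss_code \<Rightarrow> bool" where
  rotate: "move w (rotate1 w)"
| rename: "inj_on f (crossings w) \<Longrightarrow> move w (map (rename f) w)"
| R1: "move w ([Pass l c s, Pass (other_level l) c s] @ w)"
| R2: "move (u @ v)
         ([Pass Over a s, Pass Over b (opposite s)] @ u @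
          orient x [Pass Under a s, Pass Under b (opposite s)] @ v)"
| R3: "\<lbrakk>triangle x y z sa sb sc;
        ts = orient x [Pass Over a sa, Pass Over b sb];
        bs = orient y [Pass Under b sb, Pass Under c sc];
        ms = orient z [Pass Over c sc, Pass Under a sa];
        (p, q) = (ms, bs) \<or> (p, q) = (bs, ms)\<rbrakk> \<Longrightarrow>
       move (ts @ u @ p @ v @ q @ w) (rev ts @ u @ rev p @ v @ rev q @ w)"

definition diagram_move :: "gauss_code \<Rightarrow> gauss_code \<Rightarrow> bool" where
  "diagram_move D D' \<longleftrightarrow> knot_diagram D \<and> knot_diagram D' \<and> move D D'"

definition knots :: "gauss_code set set" where
  "knots = {D. knot_diagram D} // {(D, D'). knot_diagram D \<and> equivclp diagram_move D D'}"


section \<open>Arcs and colourings\<close>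

text \<open>
  Every arc starts at exactly one under-passage; an arc is named after the crossing where it
  starts. Thus the outgoing under-arc of the crossing \<open>c\<close> is the arc \<open>c\<close>, and the arc by which the
  knot arrives at a passage is named after the cyclically last under-passage before it.
\<close>

definition arc_before :: "gauss_code \<Rightarrow> nat \<Rightarrow> nat" where
  "arc_before w i = crossing (last (filter (\<lambda>p. level p = Under) (rotate i w)))"

definition under_in :: "gauss_code \<Rightarrow> nat \<Rightarrow> nat" where
  "under_in w c = arc_before w (passage_index w Under c)"

definition over_arc :: "gauss_code \<Rightarrow> nat \<Rightarrow> nat" where
  "over_arc w c = arc_before w (passage_index w Over c)"

text \<open>The linear Alexander quandle, with \<open>\<int>\<^sub>n\<close> represented by \<open>{0..<n}\<close>.\<close>

definition quandle_op :: "nat \<Rightarrow> int \<Rightarrow> int \<Rightarrow> int \<Rightarrow> int" where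
  "quandle_op n m a b = (m * a + (1 - m) * b) mod int n"

definition quandle_inv_op :: "nat \<Rightarrow> int \<Rightarrow> int \<Rightarrow> int \<Rightarrow> int" where
  "quandle_inv_op n m = quandle_op n (modular_inverse (int n) m)"

definition colourings :: "nat \<Rightarrow> int \<Rightarrow> gauss_code \<Rightarrow> (nat \<Rightarrow> int) set" where
  "colourings n m D =
     {X \<in> crossings D \<rightarrow>\<^sub>E {0..<int n}. \<forall>c\<in>crossings D.
        X c = (if positive_crossing D c
               then quandle_op n m (X (under_in D c)) (X (over_arc D c))
               else quandle_inv_op n m (X (under_in D c)) (X (over_arc D c)))}"


section \<open>Colouring matrices and the Alexander polynomial\<close>

text \<open>
  The group ring of the integers: the coefficient of \<open>m\<^sup>k\<close> in \<open>p\<close> is \<open>lookup p k\<close>, and the product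
  is the convolution.
\<close>

type_synonym laurent = "(int, int) poly_mapping"

abbreviation laurent_monom :: "int \<Rightarrow> int \<Rightarrow> laurent" where
  "laurent_monom a k \<equiv> Poly_Mapping.single k a"

definition laurent_eval :: "nat \<Rightarrow> int \<Rightarrow> laurent \<Rightarrow> int" where
  "laurent_eval n m p =
     (\<Sum>k\<in>Poly_Mapping.keys p. Poly_Mapping.lookup p k *
        (if 0 \<le> k then m ^ nat k else modular_inverse (int n) m ^ nat (- k))) mod int n"

text \<open>The lists \<open>rs\<close> and \<open>cs\<close> number the crossings (rows) and the arcs (columns).\<close>

definition colouring_matrix :: "gauss_code \<Rightarrow> nat list \<Rightarrow> nat list \<Rightarrow> laurent mat" where
  "colouring_matrix D rs cs =
     mat (length rs) (length cs) (\<lambda>(r, k).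
       let c = rs ! r;
           a = cs ! k;
           t = laurent_monom 1 (if positive_crossing D c then 1 else - 1)
       in (if a = under_in D c then t else 0)
          + (if a = over_arc D c then 1 - t else 0)
          - (if a = c then 1 else 0))"

definition colouring_matrices :: "gauss_code set \<Rightarrow> laurent mat set" where
  "colouring_matrices K =
     {colouring_matrix D rs cs | D rs cs. D \<in> K \<and> D \<noteq> [] \<and>
        distinct rs \<and> set rs = crossings D \<and> distinct cs \<and> set cs = crossings D}"

definition alexander_polynomial :: "gauss_code set \<Rightarrow> laurent \<Rightarrow> bool" where
  "alexander_polynomial K P \<longleftrightarrow>
     (\<exists>B\<in>colouring_matrices K. \<exists>k. \<exists>e\<in>{1, - 1}.
        P = laurent_monom e k * det (mat_delete B (dim_row B - 1) (dim_col B - 1)))"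

inductive matrix_operation :: "laurent mat \<Rightarrow> laurent mat \<Rightarrow> bool" where
  scale_row: "\<lbrakk>i < dim_row A; a \<in> {laurent_monom 1 1, laurent_monom 1 (- 1), - 1}\<rbrakk> \<Longrightarrow>
     matrix_operation A (multrow i a A)"
| add_row: "\<lbrakk>i < dim_row A; j < dim_row A; i \<noteq> j\<rbrakk> \<Longrightarrow> matrix_operation A (addrow 1 i j A)"
| swap_rows: "\<lbrakk>i < dim_row A; j < dim_row A\<rbrakk> \<Longrightarrow> matrix_operation A (swaprows i j A)"
| swap_cols: "\<lbrakk>i < dim_col A; j < dim_col A\<rbrakk> \<Longrightarrow> matrix_operation A (swapcols i j A)"

definition equivalent_to :: "laurent mat \<Rightarrow> laurent mat \<Rightarrow> bool" where
  "equivalent_to B A \<longleftrightarrow> matrix_operation\<^sup>*\<^sup>* A B"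

definition type_I :: "nat \<Rightarrow> laurent mat \<Rightarrow> bool" where
  "type_I N A \<longleftrightarrow> 2 \<le> N \<and> A \<in> carrier_mat N N \<and> upper_triangular A \<and>
     (\<forall>i<N - 2. A $$ (i, i) = 1) \<and>
     (\<exists>\<alpha>. A $$ (N - 2, N - 2) = \<alpha> \<and> A $$ (N - 2, N - 1) = - \<alpha>) \<and>
     A $$ (N - 1, N - 1) = 0"

end

theory Submission
  imports Defs "HOL-Number_Theory.Residues"
begin

text \<open>
  The number of colourings by \<open>\<int>\<^sub>d\<close> is invariant under Reidemeister moves, so it can be read off
  from the diagram that carries the matrix of type I: it is \<open>d * gcd (\<alpha>(m)) d\<close> for every divisor
  \<open>d\<close> of \<open>n\<close>. It can also be read off from the diagram that carries the Alexander polynomial: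
  there the last row of the colouring matrix is redundant modulo \<open>d\<close> (this needs planarity), and
  colourings are invariant under translation, so it is \<open>d\<close> times the size of the kernel of the
  minor modulo \<open>d\<close>. Hence this kernel has \<open>gcd (\<alpha>(m)) d\<close> elements for all \<open>d\<close> dividing \<open>n\<close>. These
  numbers determine the greatest common divisor of the determinant of the minor and \<open>n\<close>, without
  any comparison of determinants between the two diagrams.
\<close>

section \<open>Invariance under Reidemeister moves\<close>

text \<open>All divisors of \<open>n\<close> are counted so that no diagonalisation of the minor is
  required; adjugates suffice. If the kernel modulo \<open>p ^ f\<close> is larger than the one
  modulo \<open>p ^ (f - 1)\<close>, some kernel vector has a coordinate prime to \<open>p\<close>;
  the determinant annihilates that vector and is therefore divisible by \<open>p ^ f\<close>.
  Conversely, a kernel of at most \<open>p\<close> elements modulo \<open>p\<close> leaves some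
  cofactor prime to \<open>p\<close>, and as soon as \<open>p ^ f\<close> divides the determinant,
  the multiples of the corresponding column of the adjugate are \<open>p ^ f\<close> distinct kernel
  vectors modulo \<open>p ^ f\<close>. Finite moduli also turn the topology into counting. The
  sphere enters only through the number of faces: functions on \<open>N + 2\<close> faces are
  matched with \<open>N + 2\<close> residues that determine them, and this yields the Alexander
  numbering of the faces. Powers of the inverse of \<open>m\<close> with these numbers as exponents
  are the weights under which the colouring relations add up to zero.\<close>

text \<open>
  Instead of arcs, the passages are coloured in the order of the code: a colouring consists of the
  colour of the initial edge and the colours of the over-strands, and \<open>transport\<close> computes the
  colour of the edge after a piece of the code. In this form the empty code has \<open>q\<close> colourings,
  so the count is also invariant along moves through the diagram without crossings.
\<close>

lemma crossings_simps [simp]: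
  "crossings [] = {}"
  "crossings (p # w) = insert (crossing p) (crossings w)"
  "crossings (u @ w) = crossings u \<union> crossings w"
  "crossings (rev w) = crossings w"
  by (auto simp: crossings_def)

lemma crossings_orient [simp]: "crossings (orient b w) = crossings w"
  by (simp add: orient_def)

lemma finite_crossings [simp]: "finite (crossings w)"
  by (simp add: crossings_def)

lemma crossing_rename [simp]: "crossing (rename f p) = f (crossing p)"
  by (cases p) simp

lemma crossings_rename: "crossings (map (rename f) w) = f ` crossings w"
  by (auto simp: crossings_def image_image)

lemma opposite_opposite [simp]: "opposite (opposite s) = s"
  by (cases s) simp_all

text \<open>The inverse \<open>m'\<close> is a parameter because one inverse of \<open>m\<close>
  modulo \<open>n\<close> is also an inverse modulo every divisor of \<open>n\<close>; all these
  moduli then share the same integers \<open>m\<close> and \<open>m'\<close>.\<close>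

locale linear_quandle =
  fixes q :: nat and m m' :: int
  assumes q_pos: "q > 0" and inverse_cong: "[m * m' = 1] (mod int q)"
begin

abbreviation Zq :: "int set" where "Zq \<equiv> {0..<int q}"

primrec coef :: "crossing_sign \<Rightarrow> int" where
  "coef Pos = m"
| "coef Neg = m'"

definition act :: "crossing_sign \<Rightarrow> int \<Rightarrow> int \<Rightarrow> int" where
  "act s x y = (coef s * x + (1 - coef s) * y) mod int q"

lemma act_in [simp]: "act s x y \<in> Zq"
  using q_pos by (simp add: act_def)

lemma cong_act: "[act s x y = coef s * x + (1 - coef s) * y] (mod int q)"
  by (simp add: act_def cong_def)

lemma coef_opposite: "[coef s * coef (opposite s) = 1] (mod int q)"
  using inverse_cong by (cases s) (simp_all add: mult.commute)

lemma act_idem: "x \<in> Zq \<Longrightarrow> act s x x = x"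
  by (simp add: act_def algebra_simps)

lemma act_cancel:
  assumes "x \<in> Zq"
  shows "act (opposite s) (act s x y) y = x"
proof -
  obtain j where j: "coef s * coef (opposite s) = 1 + int q * j"
    using coef_opposite[of s] by (metis cong_iff_lin cong_sym)
  have "[coef (opposite s) * act s x y + (1 - coef (opposite s)) * y =
      coef (opposite s) * (coef s * x + (1 - coef s) * y) + (1 - coef (opposite s)) * y] (mod int q)"
    by (intro cong_add cong_mult cong_refl cong_act)
  then have "act (opposite s) (act s x y) y =
      (coef (opposite s) * (coef s * x + (1 - coef s) * y) + (1 - coef (opposite s)) * y) mod int q"
    by (simp add: act_def[of "opposite s"] cong_def)
  also have "coef (opposite s) * (coef s * x + (1 - coef s) * y) + (1 - coef (opposite s)) * y
      = (coef s * coef (opposite s)) * (x - y) + y"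
    by (simp add: algebra_simps)
  also have "\<dots> = x + int q * (j * (x - y))"
    unfolding j by (simp add: algebra_simps)
  finally show ?thesis using assms by simp
qed

lemma act_cancel':
  assumes "x \<in> Zq"
  shows "act s (act (opposite s) x y) y = x"
  using act_cancel[OF assms, of "opposite s"] by simp

lemma act_inject:
  assumes "x \<in> Zq" "x' \<in> Zq" "act s x y = act s x' y"
  shows "x = x'"
  using act_cancel assms by metis

lemma act_eq_right:
  assumes "x \<in> Zq" "y \<in> Zq"
  shows "act s x y = y \<longleftrightarrow> x = y"
  using act_inject[OF assms] act_idem assms by metis

lemma act_distrib: "act r (act s x y) z = act s (act r x z) (act r y z)"
proof -
  have "[coef r * act s x y + (1 - coef r) * z =
      coef r * (coef s * x + (1 - coef s) * y) + (1 - coef r) * z] (mod int q)"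
    by (intro cong_add cong_mult cong_refl cong_act)
  also have "coef r * (coef s * x + (1 - coef s) * y) + (1 - coef r) * z
     = coef s * (coef r * x + (1 - coef r) * z) + (1 - coef s) * (coef r * y + (1 - coef r) * z)"
    by (simp add: algebra_simps)
  also have "[\<dots> = coef s * act r x z + (1 - coef s) * act r y z] (mod int q)"
    by (intro cong_add cong_mult cong_refl cong_sym[OF cong_act])
  finally show ?thesis
    by (simp add: cong_def act_def[of r "act s x y"] act_def[of s "act r x z"])
qed

section \<open>Strand colourings and their behaviour under the moves\<close>

fun transport :: "(nat \<Rightarrow> int) \<Rightarrow> gauss_code \<Rightarrow> int \<Rightarrow> int" where
  "transport f [] y = y"
| "transport f (Pass Over c s # w) y = transport f w y"
| "transport f (Pass Under c s # w) y = transport f w (act s y (f c))"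

text \<open>The passage under a crossing may precede the passage over it, so the over-colours are
  prescribed by \<open>f\<close> in advance and compared here with the colours that actually
  arrive.\<close>

fun consistent :: "(nat \<Rightarrow> int) \<Rightarrow> gauss_code \<Rightarrow> int \<Rightarrow> bool" where
  "consistent f [] y \<longleftrightarrow> True"
| "consistent f (Pass Over c s # w) y \<longleftrightarrow> f c = y \<and> consistent f w y"
| "consistent f (Pass Under c s # w) y \<longleftrightarrow> consistent f w (act s y (f c))"

definition strand_colourings :: "gauss_code \<Rightarrow> (int \<times> (nat \<Rightarrow> int)) set" where
  "strand_colourings w = {(y, f). y \<in> Zq \<and> f \<in> crossings w \<rightarrow>\<^sub>E Zq \<and>
     consistent f w y \<and> transport f w y = y}"

lemma transport_append [simp]: "transport f (u @ v) y = transport f v (transport f u y)"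
  by (induction f u y rule: transport.induct) simp_all

lemma consistent_append [simp]:
  "consistent f (u @ v) y \<longleftrightarrow> consistent f u y \<and> consistent f v (transport f u y)"
  by (induction f u y rule: transport.induct) simp_all

lemma transport_in: "y \<in> Zq \<Longrightarrow> transport f w y \<in> Zq"
proof (induction f w y rule: transport.induct)
  case (3 f c s w y)
  then show ?case using act_in by simp
qed simp_all

lemma transport_cong:
  assumes "\<And>c. c \<in> crossings w \<Longrightarrow> f c = g c"
  shows "transport f w y = transport g w y"
  using assms by (induction f w y rule: transport.induct) simp_all

lemma consistent_cong:
  assumes "\<And>c. c \<in> crossings w \<Longrightarrow> f c = g c"
  shows "consistent f w y = consistent g w y"
  using assms by (induction f w y rule: consistent.induct) simp_all

lemma finite_strand_colourings: "finite (strand_colourings w)"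
proof (rule finite_subset)
  show "strand_colourings w \<subseteq> Zq \<times> (crossings w \<rightarrow>\<^sub>E Zq)"
    by (auto simp: strand_colourings_def)
qed (auto intro!: finite_PiE)

text \<open>Shifting the starting point past \<open>u\<close> replaces the initial colour by its
  transport along \<open>u\<close>; transport along \<open>v\<close> undoes this because the
  colouring closes up.\<close>

lemma card_strand_colourings_rotate:
  "card (strand_colourings (u @ v)) = card (strand_colourings (v @ u))"
proof (rule bij_betw_same_card[OF bij_betw_byWitness])
  let ?f = "\<lambda>(y, f). (transport f u y, f)"
  let ?g = "\<lambda>(y, f). (transport f v y, f)"
  show "\<forall>a\<in>strand_colourings (u @ v). ?g (?f a) = a"
    "\<forall>a\<in>strand_colourings (v @ u). ?f (?g a) = a"
    by (auto simp: strand_colourings_def)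
  show "?f ` strand_colourings (u @ v) \<subseteq> strand_colourings (v @ u)"
    "?g ` strand_colourings (v @ u) \<subseteq> strand_colourings (u @ v)"
    using transport_in by (auto simp: strand_colourings_def Un_commute)
qed

lemma transport_rename: "transport g (map (rename f) w) y = transport (g \<circ> f) w y"
  by (induction "g \<circ> f" w y rule: transport.induct) simp_all

lemma consistent_rename: "consistent g (map (rename f) w) y = consistent (g \<circ> f) w y"
  by (induction "g \<circ> f" w y rule: consistent.induct) simp_all

lemma card_strand_colourings_rename:
  assumes inj: "inj_on f (crossings w)"
  shows "card (strand_colourings w) = card (strand_colourings (map (rename f) w))"
proof (rule bij_betw_same_card)
  let ?C = "crossings w"
  let ?f = "\<lambda>(y, g). (y, restrict (g \<circ> inv_into ?C f) (f ` ?C))"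
  let ?g = "\<lambda>(y, g). (y, restrict (g \<circ> f) ?C)"
  show "bij_betw ?f (strand_colourings w) (strand_colourings (map (rename f) w))"
  proof (rule bij_betw_byWitness[where f' = ?g])
    show "\<forall>a\<in>strand_colourings w. ?g (?f a) = a"
      using inj by (auto simp: strand_colourings_def restrict_def fun_eq_iff PiE_iff extensional_def)
    show "\<forall>a\<in>strand_colourings (map (rename f) w). ?f (?g a) = a"
      using inj by (auto simp: strand_colourings_def restrict_def fun_eq_iff PiE_iff extensional_def
          crossings_rename)
    have "(y, restrict (g \<circ> inv_into ?C f) (f ` ?C)) \<in> strand_colourings (map (rename f) w)"
      if "(y, g) \<in> strand_colourings w" for y g
    proof -
      let ?h = "restrict (g \<circ> inv_into ?C f) (f ` ?C)"
      have "(?h \<circ> f) c = g c" if "c \<in> ?C" for c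
        using that inj by simp
      then show ?thesis
        using that inj transport_cong[of w "?h \<circ> f" g] consistent_cong[of w "?h \<circ> f" g]
        by (auto simp: strand_colourings_def transport_rename consistent_rename crossings_rename PiE_iff)
    qed
    then show "?f ` strand_colourings w \<subseteq> strand_colourings (map (rename f) w)" by auto
    have "(y, restrict (g \<circ> f) ?C) \<in> strand_colourings w"
      if "(y, g) \<in> strand_colourings (map (rename f) w)" for y g
      using that transport_cong[of w "restrict (g \<circ> f) ?C" "g \<circ> f"]
        consistent_cong[of w "restrict (g \<circ> f) ?C" "g \<circ> f"]
      by (auto simp: strand_colourings_def transport_rename consistent_rename crossings_rename PiE_iff)
    then show "?g ` strand_colourings (map (rename f) w) \<subseteq> strand_colourings w" by auto
  qed
qed

text \<open>The curl forces its over-colour to be the incoming colour \<open>y\<close>. If the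
  over-passage comes first, this is consistency; if the under-passage comes first,
  \<open>act s y (g c) = g c\<close> forces it by \<open>act_eq_right\<close>. By idempotence the
  curl then leaves \<open>y\<close> unchanged.\<close>

lemma card_strand_colourings_R1:
  assumes c: "c \<notin> crossings w"
  shows "card (strand_colourings w) =
    card (strand_colourings ([Pass l c s, Pass (other_level l) c s] @ w))"
    (is "_ = card (strand_colourings (?k @ w))")
proof (rule bij_betw_same_card)
  let ?f = "\<lambda>(y, g). (y, g(c := y))"
  let ?g = "\<lambda>(y, g). (y, g(c := undefined))"
  show "bij_betw ?f (strand_colourings w) (strand_colourings (?k @ w))"
  proof (rule bij_betw_byWitness[where f' = ?g])
    have curl: "consistent g ?k y \<and> transport g ?k y = y \<longleftrightarrow> g c = y"
      "consistent g ?k y \<Longrightarrow> transport g ?k y = y"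
      if "y \<in> Zq" "g c \<in> Zq" for g y
      using that by (cases l; auto simp: act_idem act_eq_right; metis act_eq_right)+
    have off: "transport (g(c := z)) w y = transport g w y"
      "consistent (g(c := z)) w y = consistent g w y" for g y z
      using c transport_cong[of w "g(c := z)" g] consistent_cong[of w "g(c := z)" g]
      by (metis fun_upd_other)+
    show "\<forall>a\<in>strand_colourings w. ?g (?f a) = a"
      using c by (auto simp: strand_colourings_def PiE_iff extensional_def fun_eq_iff)
    show "\<forall>a\<in>strand_colourings (?k @ w). ?f (?g a) = a"
    proof
      fix a assume "a \<in> strand_colourings (?k @ w)"
      moreover obtain y g where a: "a = (y, g)" by (cases a)
      ultimately have "y \<in> Zq" "g c \<in> Zq" "consistent g ?k y"
        by (auto simp: strand_colourings_def PiE_iff simp del: consistent.simps transport.simps append.simps)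
      then show "?f (?g a) = a" using a curl[of y g] by auto
    qed
    show "?f ` strand_colourings w \<subseteq> strand_colourings (?k @ w)"
    proof clarify
      fix y g assume a: "(y, g) \<in> strand_colourings w"
      then have "y \<in> Zq" by (auto simp: strand_colourings_def)
      then have k: "consistent (g(c := y)) ?k y" "transport (g(c := y)) ?k y = y"
        using curl(1)[of y "g(c := y)"] by auto
      show "(y, g(c := y)) \<in> strand_colourings (?k @ w)"
        using a k off by (auto simp: strand_colourings_def PiE_iff extensional_def
            simp del: consistent.simps transport.simps append.simps)
    qed
    show "?g ` strand_colourings (?k @ w) \<subseteq> strand_colourings w"
    proof clarify
      fix y g assume a: "(y, g) \<in> strand_colourings (?k @ w)"
      then have "y \<in> Zq" "g c \<in> Zq" "consistent g ?k y"
        by (auto simp: strand_colourings_def PiE_iff simp del: consistent.simps transport.simps append.simps)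
      then have "transport g ?k y = y" using curl by blast
      then show "(y, g(c := undefined)) \<in> strand_colourings w"
        using a c off by (auto simp: strand_colourings_def PiE_iff extensional_def
            simp del: consistent.simps transport.simps append.simps)
    qed
  qed
qed

text \<open>Both new over-passages lie on the initial edge, so \<open>a\<close> and \<open>b\<close>
  receive the colour \<open>y\<close>. The under-strand is acted on by the same colour with opposite
  signs, and the two actions cancel in either order.\<close>

lemma card_strand_colourings_R2:
  assumes "a \<noteq> b" "a \<notin> crossings (u @ v)" "b \<notin> crossings (u @ v)"
  shows "card (strand_colourings (u @ v)) =
    card (strand_colourings ([Pass Over a s, Pass Over b (opposite s)] @ u @
          orient x [Pass Under a s, Pass Under b (opposite s)] @ v))"
    (is "_ = card (strand_colourings ?w)")
proof (rule bij_betw_same_card)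
  let ?f = "\<lambda>(y, g). (y, g(a := y, b := y))"
  let ?g = "\<lambda>(y, g). (y, g(a := undefined, b := undefined))"
  have off: "transport (g(a := z, b := z')) u y = transport g u y"
    "transport (g(a := z, b := z')) v y = transport g v y"
    "consistent (g(a := z, b := z')) u y = consistent g u y"
    "consistent (g(a := z, b := z')) v y = consistent g v y" for g y z z'
    using assms by (auto intro!: transport_cong consistent_cong)
  have under: "consistent g (orient x [Pass Under a s, Pass Under b (opposite s)]) y"
    "z \<in> Zq \<Longrightarrow> g a = g b \<Longrightarrow>
     transport g (orient x [Pass Under a s, Pass Under b (opposite s)]) z = z" for g y z
    using act_cancel act_cancel' by (auto simp: orient_def)
  have crossings: "crossings ?w = insert a (insert b (crossings (u @ v)))"
    by (auto simp: orient_def)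
  note defs = strand_colourings_def crossings PiE_iff extensional_def
  show "bij_betw ?f (strand_colourings (u @ v)) (strand_colourings ?w)"
  proof (rule bij_betw_byWitness[where f' = ?g])
    show "\<forall>x\<in>strand_colourings (u @ v). ?g (?f x) = x"
      using assms by (auto simp: defs fun_eq_iff)
    show "\<forall>x\<in>strand_colourings ?w. ?f (?g x) = x"
      using assms by (auto simp: defs fun_eq_iff)
    show "?f ` strand_colourings (u @ v) \<subseteq> strand_colourings ?w"
      using assms off under transport_in by (auto simp: defs)
    show "?g ` strand_colourings ?w \<subseteq> strand_colourings (u @ v)"
    proof (rule image_subsetI)
      fix a' assume "a' \<in> strand_colourings ?w"
      moreover obtain y g where a': "a' = (y, g)" by (cases a')
      ultimately have g: "(y, g) \<in> strand_colourings ?w" by simp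
      then have y: "y \<in> Zq" "g a = y" "g b = y" by (auto simp: defs)
      have t: "transport g (orient x [Pass Under a s, Pass Under b (opposite s)])
         (transport g u y) = transport g u y"
        using y under transport_in by metis
      show "?g a' \<in> strand_colourings (u @ v)"
        using g off y t assms unfolding a' by (auto simp: defs)
    qed
  qed
qed

text \<open>The two sides are related by recolouring the middle strand, hence the over-colour
  of \<open>c\<close>, inside the triangle. Self-distributivity makes the two bottom strands agree.\<close>

lemma strand_colourings_R3_le:
  assumes tri: "triangle x d z sa sb sc"
    and ts: "ts = orient x [Pass Over a sa, Pass Over b sb]"
    and bs: "bs = orient d [Pass Under b sb, Pass Under c sc]"
    and ms: "ms = orient z [Pass Over c sc, Pass Under a sa]"
    and pq: "(p, q') = (ms, bs) \<or> (p, q') = (bs, ms)"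
    and wf: "well_formed (ts @ u @ p @ v @ q' @ w)"
  shows "card (strand_colourings (ts @ u @ p @ v @ q' @ w)) \<le>
     card (strand_colourings (rev ts @ u @ rev p @ v @ rev q' @ w))"
    (is "card (strand_colourings ?w) \<le> card (strand_colourings ?w')")
proof (rule card_inj_on_le)
  \<comment> \<open>If \<open>z\<close> holds, the middle strand passes over \<open>c\<close> before
    it dives under \<open>a\<close>; after the move it arrives at \<open>c\<close> having already
    been acted on with sign \<open>sa\<close>. Otherwise the move removes that action, hence the
    opposite sign.\<close>
  let ?r = "if z then sa else opposite sa"
  let ?f = "\<lambda>(y, g). (y, g(c := act ?r (g c) (g a)))"
  let ?L = "\<lambda>p. (level p, crossing p)"
  have distinct: "distinct (map ?L ?w)"
    using wf by (simp add: well_formed_def)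
  have pq': "p = ms \<and> q' = bs \<or> p = bs \<and> q' = ms"
    using pq by simp
  have perm: "distinct (T @ B @ M)" "set (U @ V @ W) \<inter> set (T @ B @ M) = {}"
    if "distinct (T @ U @ P @ V @ Q @ W)" "P = M \<and> Q = B \<or> P = B \<and> Q = M"
    for T B M U V W P Q :: "(level \<times> nat) list"
    using that by auto
  have "distinct (map ?L ts @ map ?L u @ map ?L p @ map ?L v @ map ?L q' @ map ?L w)"
    using distinct by (simp only: map_append)
  note blocks = perm[OF this, of "map ?L ms" "map ?L bs"]
  have "map ?L p = map ?L ms \<and> map ?L q' = map ?L bs \<or>
      map ?L p = map ?L bs \<and> map ?L q' = map ?L ms"
    using pq' by blast
  note blocks = blocks[OF this]
  from blocks(1) have abc: "a \<noteq> b" "c \<noteq> a" "c \<noteq> b"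
    unfolding ts bs ms by (auto simp: orient_def split: if_splits)
  have "?L ` set (u @ v @ w) \<inter> ?L ` set (ts @ bs @ ms) = {}"
    using blocks(2) by (simp only: map_append[symmetric] set_map)
  moreover have levels: "UNIV = {Over, Under}"
    by (auto intro: level.exhaust)
  have "?L ` set (ts @ bs @ ms) = UNIV \<times> {a, b, c}"
    unfolding ts bs ms levels orient_def by auto
  moreover have "(level p, crossing p) \<in> UNIV \<times> {a, b, c}"
    if "p \<in> set (u @ v @ w)" "crossing p \<in> {a, b, c}" for p
    using that by auto
  \<comment> \<open>Both passages through each of \<open>a\<close>, \<open>b\<close>,
    \<open>c\<close> are used up by the triangle, so by distinctness the rest of the code avoids
    these crossings and does not notice the recolouring.\<close>
  ultimately have uvw: "crossings (u @ v @ w) \<inter> {a, b, c} = {}"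
    unfolding crossings_def by fast
  have crossings: "crossings ?w = insert a (insert b (insert c (crossings (u @ v @ w))))"
    "crossings ?w' = crossings ?w"
    using pq' unfolding ts bs ms by auto
  have over: "g a = y" "g b = y" if "(y, g) \<in> strand_colourings ?w" for y g
    using that unfolding strand_colourings_def ts by (auto simp: orient_def split: if_splits)
  have Zq: "g c \<in> Zq" "g a \<in> Zq" "y \<in> Zq" "g \<in> crossings ?w \<rightarrow>\<^sub>E Zq"
    if "(y, g) \<in> strand_colourings ?w" for y g
    using that unfolding strand_colourings_def crossings(1) PiE_iff by auto
  show "inj_on ?f (strand_colourings ?w)"
  proof (rule inj_onI)
    fix h h' assume h: "h \<in> strand_colourings ?w" "h' \<in> strand_colourings ?w" "?f h = ?f h'"
    obtain y g y' g' where eq: "h = (y, g)" "h' = (y', g')" by (cases h, cases h')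
    have upd: "y = y'" "g(c := act ?r (g c) (g a)) = g'(c := act ?r (g' c) (g' a))"
      using h(3) by (simp_all add: eq)
    have "g i = g' i" if "i \<noteq> c" for i
      using fun_cong[OF upd(2), of i] that by simp
    moreover have "act ?r (g c) (g a) = act ?r (g' c) (g a)"
      using fun_cong[OF upd(2), of c] \<open>y = y'\<close> over(1)[of y g] over(1)[of y' g'] h(1,2)
      by (simp add: eq)
    then have "g c = g' c"
      by (rule act_inject[rotated 2]) (use Zq h eq in auto)
    ultimately show "h = h'" using eq upd(1) by fastforce
  qed
  show "?f ` strand_colourings ?w \<subseteq> strand_colourings ?w'"
  proof (rule image_subsetI)
    fix h assume h: "h \<in> strand_colourings ?w"
    obtain y g where yg': "h = (y, g)" by (cases h)
    have yg: "(y, g) \<in> strand_colourings ?w" using h yg' by simp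
    let ?g = "g(c := act ?r (g c) (g a))"
    note Z = Zq[OF yg] and o = over[OF yg]
    have g': "?g \<in> crossings ?w' \<rightarrow>\<^sub>E Zq"
      using Z(4) act_in unfolding crossings(2) unfolding crossings(1)
      by (auto simp: PiE_iff extensional_def)
    have off: "transport ?g u k = transport g u k" "consistent ?g u k = consistent g u k"
      "transport ?g v k = transport g v k" "consistent ?g v k = consistent g v k"
      "transport ?g w k = transport g w k" "consistent ?g w k = consistent g w k" for k
      using uvw by (auto intro!: transport_cong consistent_cong)
    have top: "consistent ?g (rev ts) y" "transport ?g (rev ts) y = y" "transport g ts y = y"
      using o abc unfolding ts orient_def by auto
    have middle: "consistent ?g (rev ms) k \<and> transport ?g (rev ms) k = transport g ms k"
      if "consistent g ms k" "k \<in> Zq" for k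
      using that abc act_cancel act_cancel' unfolding ms orient_def
      by (auto split: if_splits)
    have bottom: "consistent ?g (rev bs) k \<and> transport ?g (rev bs) k = transport g bs k"
      if "k \<in> Zq" for k
    proof -
      \<comment> \<open>This is where the geometry of the triangle enters: acting by the top colour
        with sign \<open>sb\<close> carries the new over-colour of \<open>c\<close> to the old one
        if \<open>d\<close> holds, and the old one to the new one otherwise. That is the form in
        which \<open>act_distrib\<close> applies.\<close>
      have sb: "sb = (if d then opposite ?r else ?r)"
        using tri by (cases sa; cases sb) (auto simp: triangle_def)
      have "consistent ?g (rev bs) k"
        unfolding bs orient_def by auto
      moreover have "transport ?g (rev bs) k = transport g bs k"
      proof (cases d)
        case True
        then have "act sb (act ?r (g c) (g a)) (g a) = g c"
          using act_cancel[OF Z(1)] sb by simp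
        then show ?thesis
          using True abc o act_distrib[of sb sc k "act ?r (g c) (g a)" "g a"]
          unfolding bs orient_def by simp
      next
        case False
        then have "act sb (g c) (g a) = act ?r (g c) (g a)"
          using sb by simp
        then show ?thesis
          using False abc o act_distrib[of sb sc k "g c" "g a"]
          unfolding bs orient_def by simp
      qed
      ultimately show ?thesis by blast
    qed
    have *: "consistent ?g (u @ rev p @ v @ rev q' @ w) y \<and>
         transport ?g (u @ rev p @ v @ rev q' @ w) y = transport g (u @ p @ v @ q' @ w) y"
      if "consistent g (u @ p @ v @ q' @ w) y"
    proof -
      have "consistent ?g (rev p) k \<and> transport ?g (rev p) k = transport g p k"
        if "consistent g p k" "k \<in> Zq" for k
        using pq' that middle bottom by blast
      moreover have "consistent ?g (rev q') k \<and> transport ?g (rev q') k = transport g q' k"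
        if "consistent g q' k" "k \<in> Zq" for k
        using pq' that middle bottom by blast
      moreover note transport_in[OF Z(3), of g u]
        transport_in[OF transport_in[OF transport_in[OF Z(3)]], of g v g p g u]
      ultimately show ?thesis using that off by simp
    qed
    then have "(y, ?g) \<in> strand_colourings ?w'"
      using yg g' top Z(3) unfolding strand_colourings_def by simp
    then show "?f h \<in> strand_colourings ?w'" unfolding yg' by simp
  qed
  show "finite (strand_colourings ?w')" by (rule finite_strand_colourings)
qed

lemma card_strand_colourings_move:
  assumes "move w w'" "well_formed w" "well_formed w'"
  shows "card (strand_colourings w) = card (strand_colourings w')"
  using assms
proof (induction rule: move.induct)
  case (rotate w)
  show ?case
    using card_strand_colourings_rotate[of "[hd w]" "tl w"] by (cases w) simp_all
next
  case (rename f w)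
  then show ?case by (simp add: card_strand_colourings_rename)
next
  case (R1 w l c s)
  have "c \<notin> crossings w"
  proof
    assume "c \<in> crossings w"
    then obtain p where "p \<in> set w" "crossing p = c" by (auto simp: crossings_def)
    then show False
      using R1(2) by (cases "level p"; cases l) (force simp: well_formed_def image_iff)+
  qed
  then show ?case by (rule card_strand_colourings_R1)
next
  case (R2 u v a s b x)
  let ?o = "orient x [Pass Under a s, Pass Under b (opposite s)]"
  have "set (map (\<lambda>p. (level p, crossing p)) ?o) = {(Under, a), (Under, b)}"
    by (auto simp: orient_def)
  then have off: "k \<notin> crossings (u @ v)" if "k \<in> {a, b}" for k
  proof -
    have "(l, k) \<notin> (\<lambda>p. (level p, crossing p)) ` set (u @ v)" for l
      using R2(2) that \<open>set (map _ ?o) = _\<close>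
      by (cases l) (auto simp: well_formed_def simp del: distinct_map)
    then show ?thesis by (auto simp: crossings_def image_iff)
  qed
  moreover have "a \<noteq> b" using R2(2) by (auto simp: well_formed_def)
  ultimately show ?case using card_strand_colourings_R2 by simp
next
  case (R3 x y z sa sb sc ts a b bs c ms p q' u v w)
  have flip: "rev (orient d xs) = orient (\<not> d) xs" for d and xs :: "passage list"
    by (simp add: orient_def)
  \<comment> \<open>\<open>triangle\<close> only compares flags with each other, so negating all
    three preserves it. The reversed move is thus again of the same kind, and the inequality holds
    in both directions.\<close>
  have tri: "triangle (\<not> x) (\<not> y) (\<not> z) sa sb sc"
    using R3(1) by (auto simp: triangle_def)
  have pq: "(rev p, rev q') = (rev ms, rev bs) \<or> (rev p, rev q') = (rev bs, rev ms)"
    using R3(5) by auto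
  show ?case
    using strand_colourings_R3_le[OF R3(1-5), of u v w] R3(6,7)
      strand_colourings_R3_le[OF tri R3(2-4)[THEN arg_cong[of _ _ rev], unfolded flip[of x] flip[of y] flip[of z]] pq, of u v w]
    by simp
qed

end

section \<open>Colourings of the arcs\<close>

definition crossing_sign :: "gauss_code \<Rightarrow> nat \<Rightarrow> crossing_sign" where
  "crossing_sign w c = (if positive_crossing w c then Pos else Neg)"

lemma passage_index_nth:
  assumes "well_formed w" "i < length w"
  shows "passage_index w (level (w ! i)) (crossing (w ! i)) = i"
  unfolding passage_index_def
proof (rule the_equality)
  have "distinct (map (\<lambda>p. (level p, crossing p)) w)"
    using assms by (simp add: well_formed_def)
  then show "j = i"
    if "j < length w \<and> level (w ! j) = level (w ! i) \<and> crossing (w ! j) = crossing (w ! i)" for j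
    using that assms(2) nth_eq_iff_index_eq[of "map (\<lambda>p. (level p, crossing p)) w" i j] by simp
qed (use assms in simp)

lemma well_formed_levels:
  assumes "well_formed w" "c \<in> crossings w"
  obtains s where "\<And>l. Pass l c s \<in> set w"
proof -
  from assms obtain l s where p: "Pass l c s \<in> set w"
    by (metis crossings_def imageE passage.exhaust_sel)
  then have o: "Pass (other_level l) c s \<in> set w"
    using assms by (auto simp: well_formed_def)
  have "Pass l' c s \<in> set w" for l'
    using p o by (cases l; cases l') simp_all
  then show thesis by (rule that)
qed

lemma passage_index:
  assumes "well_formed w" "c \<in> crossings w"
  shows passage_index_less: "passage_index w l c < length w"
    and level_passage_index: "level (w ! passage_index w l c) = l"
    and crossing_passage_index: "crossing (w ! passage_index w l c) = c"
proof -
  obtain s where "Pass l c s \<in> set w"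
    using well_formed_levels[OF assms] by metis
  then obtain i where "i < length w" "w ! i = Pass l c s"
    by (auto simp: in_set_conv_nth)
  with passage_index_nth[OF assms(1) this(1)]
  show "passage_index w l c < length w" "level (w ! passage_index w l c) = l"
    "crossing (w ! passage_index w l c) = c" by simp_all
qed

text \<open>The two passages of a crossing carry the same sign by well-formedness, and distinctness
  allows only one over-passage, whose sign is the one tested by
  \<open>positive_crossing\<close>.\<close>

lemma csign_eq:
  assumes wf: "well_formed w" and p: "p \<in> set w"
  shows "csign p = crossing_sign w (crossing p)"
proof -
  obtain l c s where pe: "p = Pass l c s" by (cases p)
  have d: "distinct (map (\<lambda>p. (level p, crossing p)) w)"
    using wf by (simp add: well_formed_def)
  have "Pass (other_level l) c s \<in> set w"
    using wf p pe by (auto simp: well_formed_def)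
  then have o: "Pass Over c s \<in> set w" using p pe by (cases l) simp_all
  have "Pass Over c Pos \<in> set w \<longleftrightarrow> s = Pos"
    using o d by (auto simp: distinct_map inj_on_def) (metis passage.sel)
  then show ?thesis
    using pe by (cases s) (auto simp: crossing_sign_def positive_crossing_def)
qed

lemma arc_before_Suc:
  assumes "i < length w"
  shows "arc_before w (Suc i) = (if level (w ! i) = Under then crossing (w ! i) else arc_before w i)"
proof -
  have "rotate i w = w ! i # drop (Suc i) w @ take i w"
    using assms by (simp add: rotate_drop_take Cons_nth_drop_Suc)
  then show ?thesis
    by (simp add: arc_before_def)
qed

lemma arc_before_length [simp]: "arc_before w (length w) = arc_before w 0"
  by (simp add: arc_before_def)

lemma crossings_nonempty: "w \<noteq> [] \<Longrightarrow> crossings w \<noteq> {}"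
  by (simp add: crossings_def)

lemma arc_before_in_crossings:
  assumes "well_formed w" "w \<noteq> []"
  shows "arc_before w i \<in> crossings w"
proof -
  obtain c where "c \<in> crossings w" using crossings_nonempty assms by blast
  then obtain s where "Pass Under c s \<in> set w"
    using well_formed_levels assms(1) by metis
  then have "filter (\<lambda>p. level p = Under) (rotate i w) \<noteq> []"
    by (force simp: filter_empty_conv)
  from last_in_set[OF this] show ?thesis
    by (auto simp: arc_before_def crossings_def)
qed

text \<open>A function on the edges that changes only at under-passages is read off right behind the
  under-passage at which the arc starts. The walk begins in the middle of an arc; until the first
  under-passage the induction can only record that nothing has changed, and \<open>cyclic\<close>
  settles this initial piece after a full turn.\<close>

lemma value_on_arc:
  assumes wf: "well_formed w" and nonempty: "w \<noteq> []"
    and over: "\<And>i. i < length w \<Longrightarrow> level (w ! i) = Over \<Longrightarrow> Y (Suc i) = Y i"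
    and cyclic: "Y (length w) = Y 0" and i: "i \<le> length w"
  shows "Y i = Y (Suc (passage_index w Under (arc_before w i)))" (is "?P i")
proof -
  have *: "?P i \<or> arc_before w i = arc_before w 0 \<and> Y i = Y 0 \<and> (\<forall>j<i. level (w ! j) = Over)"
    if "i \<le> length w" for i
    using that
  proof (induction i)
    case (Suc i)
    show ?case
    proof (cases "level (w ! i)")
      case Over
      then have "arc_before w (Suc i) = arc_before w i" "Y (Suc i) = Y i"
        using arc_before_Suc[of i w] over Suc(2) by simp_all
      then show ?thesis using Suc Over by (auto simp: less_Suc_eq)
    next
      case Under
      then show ?thesis
        using arc_before_Suc[of i w] passage_index_nth[OF wf, of i] Suc(2) by simp
    qed
  qed simp
  obtain c where c: "c \<in> crossings w" using crossings_nonempty nonempty by blast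
  have "\<not> (\<forall>j<length w. level (w ! j) = Over)"
    using passage_index_less[OF wf c, of Under] level_passage_index[OF wf c, of Under] by auto
  then have "?P 0" using *[of "length w"] cyclic by auto
  then show ?thesis using *[OF i] by metis
qed

context linear_quandle begin

definition arc_colourings :: "gauss_code \<Rightarrow> (nat \<Rightarrow> int) set" where
  "arc_colourings w = {X \<in> crossings w \<rightarrow>\<^sub>E Zq. \<forall>c\<in>crossings w.
     X c = act (crossing_sign w c) (X (under_in w c)) (X (over_arc w c))}"

lemma transport_Over: "level p = Over \<Longrightarrow> transport g [p] y = y"
  by (cases p) simp

lemma transport_Under: "level p = Under \<Longrightarrow> transport g [p] y = act (csign p) y (g (crossing p))"
  by (cases p) simp

lemma consistent_singleton: "consistent g [p] y \<longleftrightarrow> (level p = Over \<longrightarrow> g (crossing p) = y)"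
  by (cases p; cases "level p") simp_all

lemma consistent_nth:
  assumes "consistent g w y" "i < length w" "level (w ! i) = Over"
  shows "g (crossing (w ! i)) = transport g (take i w) y"
proof -
  have "consistent g (take i w @ [w ! i] @ drop (Suc i) w) y"
    using assms by (simp add: Cons_nth_drop_Suc)
  then have "consistent g [w ! i] (transport g (take i w) y)"
    unfolding consistent_append by blast
  then show ?thesis using assms(3) by (simp add: consistent_singleton)
qed

text \<open>An arc colouring supplies the colour of the initial edge and those of the over-strands.
  Conversely, arc \<open>c\<close> gets the colour just behind the under-passage of
  \<open>c\<close>, which explains the \<open>Suc\<close> in \<open>?G\<close>. The empty code is
  excluded: it has a single arc colouring but \<open>q\<close> strand colourings.\<close>

lemma card_arc_colourings:
  assumes wf: "well_formed w" and ne: "w \<noteq> []"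
  shows "card (arc_colourings w) = card (strand_colourings w)"
proof (rule bij_betw_same_card)
  let ?C = "crossings w"
  let ?F = "\<lambda>X. (X (arc_before w 0), restrict (\<lambda>c. X (over_arc w c)) ?C)"
  let ?G = "\<lambda>(y, g). restrict (\<lambda>c. transport g (take (Suc (passage_index w Under c)) w) y) ?C"
  note [simp] = arc_before_in_crossings[OF wf ne]
  have F: "transport g (take i w) y = X (arc_before w i) \<and> consistent g (take i w) y"
    if X: "X \<in> arc_colourings w" and yg: "(y, g) = ?F X" and i: "i \<le> length w" for X y g i
    using i
  proof (induction i)
    case 0
    then show ?case using yg by simp
  next
    case (Suc i)
    let ?p = "w ! i"
    have i: "i < length w" using Suc by simp
    then have p: "?p \<in> set w" and c: "crossing ?p \<in> ?C" by (auto simp: crossings_def)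
    have take: "take (Suc i) w = take i w @ [?p]" using i by (simp add: take_Suc_conv_app_nth)
    have IH: "transport g (take i w) y = X (arc_before w i)" "consistent g (take i w) y"
      using Suc by simp_all
    have g: "g (crossing ?p) = X (over_arc w (crossing ?p))"
      using yg c by simp
    show ?case
    proof (cases "level ?p")
      case Over
      then have "over_arc w (crossing ?p) = arc_before w i"
        using passage_index_nth[OF wf i] by (simp add: over_arc_def)
      then show ?thesis
        using Over take IH g arc_before_Suc[OF i]
        by (simp add: transport_Over consistent_singleton)
    next
      case Under
      then have "under_in w (crossing ?p) = arc_before w i"
        using passage_index_nth[OF wf i] by (simp add: under_in_def)
      moreover have "X (crossing ?p) = act (csign ?p) (X (under_in w (crossing ?p)))
          (X (over_arc w (crossing ?p)))"
        using X c csign_eq[OF wf p] by (simp add: arc_colourings_def)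
      ultimately show ?thesis
        using Under take IH g arc_before_Suc[OF i]
        by (simp add: transport_Under consistent_singleton)
    qed
  qed
  have G: "?G (y, g) (arc_before w i) = transport g (take i w) y"
    if "(y, g) \<in> strand_colourings w" "i \<le> length w" for y g i
  proof -
    have "transport g (take i w) y =
        transport g (take (Suc (passage_index w Under (arc_before w i))) w) y"
    proof (rule value_on_arc[OF wf ne _ _ that(2)])
      show "transport g (take (length w) w) y = transport g (take 0 w) y"
        using that by (simp add: strand_colourings_def)
    qed (simp add: take_Suc_conv_app_nth transport_Over)
    then show ?thesis by simp
  qed
  have over: "g c = transport g (take (passage_index w Over c) w) y"
    if "(y, g) \<in> strand_colourings w" "c \<in> ?C" for y g c
    using consistent_nth[of g w y "passage_index w Over c"] passage_index[OF wf that(2), of Over] that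
    by (simp add: strand_colourings_def)
  show "bij_betw ?F (arc_colourings w) (strand_colourings w)"
  proof (rule bij_betw_byWitness[where f' = ?G])
    show "\<forall>X\<in>arc_colourings w. ?G (?F X) = X"
    proof (intro ballI ext)
      fix X c assume X: "X \<in> arc_colourings w"
      obtain y g where yg: "(y, g) = ?F X" by simp
      show "?G (?F X) c = X c"
      proof (cases "c \<in> ?C")
        case True
        then show ?thesis
          using F[OF X yg, of "Suc (passage_index w Under c)"] passage_index[OF wf True, of Under]
            arc_before_Suc[of "passage_index w Under c" w]
          unfolding yg[symmetric] by simp
      next
        case False
        then show ?thesis using X by (auto simp: arc_colourings_def)
      qed
    qed
    show "\<forall>h\<in>strand_colourings w. ?F (?G h) = h"
    proof
      fix h assume "h \<in> strand_colourings w"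
      moreover obtain y g where h: "h = (y, g)" by (cases h)
      ultimately have yg: "(y, g) \<in> strand_colourings w" by simp
      have "restrict (\<lambda>c. ?G (y, g) (over_arc w c)) ?C = g"
      proof
        fix c
        show "restrict (\<lambda>c. ?G (y, g) (over_arc w c)) ?C c = g c"
        proof (cases "c \<in> ?C")
          case True
          then show ?thesis
            using over[OF yg True] G[OF yg, of "passage_index w Over c"]
              passage_index_less[OF wf True, of Over]
            by (simp add: over_arc_def)
        next
          case False
          then show ?thesis using yg by (auto simp: strand_colourings_def)
        qed
      qed
      moreover have "?G (y, g) (arc_before w 0) = y"
        using G[OF yg, of 0] by simp
      ultimately show "?F (?G h) = h" unfolding h by simp
    qed
    show "?F ` arc_colourings w \<subseteq> strand_colourings w"
    proof (rule image_subsetI)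
      fix X assume X: "X \<in> arc_colourings w"
      obtain y g where yg: "(y, g) = ?F X" by simp
      have "X c \<in> Zq" if "c \<in> ?C" for c using X that by (simp only: arc_colourings_def) (blast intro: PiE_mem)
      then have "y \<in> Zq" "g \<in> ?C \<rightarrow>\<^sub>E Zq"
        using yg by (simp_all add: over_arc_def)
      then have "(y, g) \<in> strand_colourings w"
        using F[OF X yg, of "length w"] yg by (simp add: strand_colourings_def)
      then show "?F X \<in> strand_colourings w" using yg by simp
    qed
    show "?G ` strand_colourings w \<subseteq> arc_colourings w"
    proof (rule image_subsetI)
      fix h assume "h \<in> strand_colourings w"
      moreover obtain y g where h: "h = (y, g)" by (cases h)
      ultimately have yg: "(y, g) \<in> strand_colourings w" by simp
      then have "y \<in> Zq" by (simp add: strand_colourings_def)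
      then have "?G (y, g) \<in> ?C \<rightarrow>\<^sub>E Zq"
        using transport_in by simp
      moreover have "?G (y, g) c = act (crossing_sign w c) (?G (y, g) (under_in w c)) (?G (y, g) (over_arc w c))"
        if c: "c \<in> ?C" for c
      proof -
        note u = passage_index[OF wf c, of Under] and o = passage_index_less[OF wf c, of Over]
        have s: "csign (w ! passage_index w Under c) = crossing_sign w c"
          using csign_eq[OF wf, of "w ! passage_index w Under c"] u by simp
        have "?G (y, g) c = act (crossing_sign w c) (transport g (take (passage_index w Under c) w) y) (g c)"
          using c u s by (simp add: take_Suc_conv_app_nth transport_Under)
        then show ?thesis
          using G[OF yg, of "passage_index w Under c"] G[OF yg, of "passage_index w Over c"]
            u o over[OF yg c] by (simp add: under_in_def over_arc_def)
      qed
      ultimately show "?G h \<in> arc_colourings w"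
        unfolding h arc_colourings_def by blast
    qed
  qed
qed

end

section \<open>Kernels modulo the divisors of a number\<close>

definition mod_vectors :: "nat \<Rightarrow> nat \<Rightarrow> (nat \<Rightarrow> int) set" where
  "mod_vectors d k = {..<k} \<rightarrow>\<^sub>E {0..<int d}"

definition mat_apply :: "int mat \<Rightarrow> (nat \<Rightarrow> int) \<Rightarrow> nat \<Rightarrow> int" where
  "mat_apply M x i = (\<Sum>j<dim_col M. M $$ (i, j) * x j)"

definition mod_kernel :: "nat \<Rightarrow> int mat \<Rightarrow> (nat \<Rightarrow> int) set" where
  "mod_kernel d M =
     {x \<in> mod_vectors d (dim_col M). \<forall>i<dim_row M. [mat_apply M x i = 0] (mod int d)}"

lemma finite_mod_vectors [simp]: "finite (mod_vectors d k)"
  by (simp add: mod_vectors_def finite_PiE)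

lemma card_mod_vectors [simp]: "card (mod_vectors d k) = d ^ k"
  by (simp add: mod_vectors_def card_PiE)

lemma finite_mod_kernel [simp]: "finite (mod_kernel d M)"
  by (rule finite_subset[OF _ finite_mod_vectors]) (auto simp: mod_kernel_def)

lemma mod_vectors_eqI:
  assumes "x \<in> mod_vectors d k" "y \<in> mod_vectors d k" "\<And>j. j < k \<Longrightarrow> [x j = y j] (mod int d)"
  shows "x = y"
proof
  fix j
  show "x j = y j"
  proof (cases "j < k")
    case True
    then have "x j \<in> {0..<int d}" "y j \<in> {0..<int d}"
      using assms(1,2) by (auto simp: mod_vectors_def PiE_iff)
    then show ?thesis using assms(3)[OF True] by (simp add: cong_def)
  next
    case False
    then show ?thesis using assms(1,2) by (simp add: mod_vectors_def PiE_iff extensional_def)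
  qed
qed

definition vec_mod :: "nat \<Rightarrow> nat \<Rightarrow> (nat \<Rightarrow> int) \<Rightarrow> nat \<Rightarrow> int" where
  "vec_mod d k x = (\<lambda>j\<in>{..<k}. x j mod int d)"

lemma vec_mod_in: "d > 0 \<Longrightarrow> vec_mod d k x \<in> mod_vectors d k"
  by (simp add: vec_mod_def mod_vectors_def)

lemma vec_mod_cong: "j < k \<Longrightarrow> [vec_mod d k x j = x j] (mod int d)"
  by (simp add: vec_mod_def cong_def)

lemma mat_apply_cong:
  assumes "\<And>j. j < dim_col M \<Longrightarrow> [x j = y j] (mod c)"
  shows "[mat_apply M x i = mat_apply M y i] (mod c)"
  unfolding mat_apply_def using assms by (intro cong_sum cong_mult cong_refl) simp

lemma mat_apply_scale: "mat_apply M (\<lambda>j. c * x j) i = c * mat_apply M x i"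
  by (simp add: mat_apply_def sum_distrib_left ac_simps)

lemma mat_apply_diff: "mat_apply M (\<lambda>j. x j - y j) i = mat_apply M x i - mat_apply M y i"
  by (simp add: mat_apply_def sum_subtractf algebra_simps)

lemma det_cong:
  fixes A B :: "int mat"
  assumes "A \<in> carrier_mat n n" "B \<in> carrier_mat n n"
    and "\<And>i j. i < n \<Longrightarrow> j < n \<Longrightarrow> [A $$ (i, j) = B $$ (i, j)] (mod c)"
  shows "[det A = det B] (mod c)"
  unfolding det_def'[OF assms(1)] det_def'[OF assms(2)]
  using assms(3) by (intro cong_sum cong_mult cong_refl cong_prod) (auto simp: permutes_in_image)

lemma mat_apply_mult:
  assumes "A \<in> carrier_mat k k" "B \<in> carrier_mat k k" "i < k"
  shows "mat_apply A (mat_apply B x) i = mat_apply (A * B) x i"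
proof -
  have "mat_apply (A * B) x i = (\<Sum>j<k. (\<Sum>l<k. A $$ (i, l) * B $$ (l, j)) * x j)"
    using assms by (auto simp: mat_apply_def scalar_prod_def atLeast0LessThan intro!: sum.cong)
  also have "\<dots> = (\<Sum>l<k. A $$ (i, l) * (\<Sum>j<k. B $$ (l, j) * x j))"
    by (simp add: sum_distrib_left sum_distrib_right mult.assoc) (rule sum.swap)
  finally show ?thesis using assms by (simp add: mat_apply_def)
qed

lemma mat_apply_scalar_mat: "i < k \<Longrightarrow> mat_apply (c \<cdot>\<^sub>m 1\<^sub>m k) x i = c * x i"
  by (simp add: mat_apply_def if_distrib[of "(*) c"] if_distrib[of "\<lambda>a. a * _"] sum.delta cong: if_cong)

section \<open>Determinants, adjugates and the size of kernels\<close>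

text \<open>Cramer's rule: multiply the vector of congruences by the adjugate.\<close>

lemma det_times_kernel:
  assumes M: "M \<in> carrier_mat k k" and x: "\<And>i. i < k \<Longrightarrow> [mat_apply M x i = 0] (mod c)" and j: "j < k"
  shows "[det M * x j = 0] (mod c)"
proof -
  have "det M * x j = mat_apply (adj_mat M) (mat_apply M x) j"
    using adj_mat[OF M] mat_apply_mult[OF adj_mat(1)[OF M] M j, of x] j
    by (simp add: mat_apply_scalar_mat)
  also have "[\<dots> = mat_apply (adj_mat M) (\<lambda>_. 0) j] (mod c)"
    using x adj_mat(1)[OF M] by (intro mat_apply_cong) simp
  also have "mat_apply (adj_mat M) (\<lambda>_. 0) j = 0" by (simp add: mat_apply_def)
  finally show ?thesis .
qed

text \<open>If \<open>p\<close> divided every coordinate of every kernel vector modulo \<open>p ^ Suc f\<close>, dividing by \<open>p\<close>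
  would embed that kernel into the kernel modulo \<open>p ^ f\<close>, which is too small.\<close>

lemma prime_power_dvd_det:
  assumes p: "prime p" and M: "M \<in> carrier_mat k k"
    and card: "card (mod_kernel (p ^ f) M) < card (mod_kernel (p ^ Suc f) M)"
  shows "int (p ^ Suc f) dvd det M"
proof -
  have p0: "p > 0" using p prime_gt_0_nat by blast
  have dims: "dim_row M = k" "dim_col M = k" using M by auto
  have "\<exists>x\<in>mod_kernel (p ^ Suc f) M. \<exists>j<k. \<not> int p dvd x j"
  proof (rule ccontr)
    assume "\<not> ?thesis"
    then have dvd: "int p dvd x j" if "x \<in> mod_kernel (p ^ Suc f) M" "j < k" for x j
      using that by blast
    let ?h = "\<lambda>x. \<lambda>j\<in>{..<k}. x j div int p"
    have "inj_on ?h (mod_kernel (p ^ Suc f) M)"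
    proof (rule inj_onI)
      fix x y assume x: "x \<in> mod_kernel (p ^ Suc f) M" and y: "y \<in> mod_kernel (p ^ Suc f) M"
        and eq: "?h x = ?h y"
      show "x = y"
      proof (rule mod_vectors_eqI)
        show "x \<in> mod_vectors (p ^ Suc f) k" "y \<in> mod_vectors (p ^ Suc f) k"
          using x y by (simp_all add: mod_kernel_def dims)
        fix j assume j: "j < k"
        then have "x j div int p = y j div int p" using fun_cong[OF eq, of j] by simp
        then have "x j = y j" using dvd[OF x j] dvd[OF y j] by (metis dvd_mult_div_cancel)
        then show "[x j = y j] (mod int (p ^ Suc f))" by simp
      qed
    qed
    moreover have "?h ` mod_kernel (p ^ Suc f) M \<subseteq> mod_kernel (p ^ f) M"
    proof (rule image_subsetI)
      fix x assume x: "x \<in> mod_kernel (p ^ Suc f) M"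
      have "x j div int p \<in> {0..<int (p ^ f)}" if j: "j < k" for j
      proof -
        obtain t where t: "x j = int p * t" using dvd[OF x j] by blast
        have "0 \<le> x j" "x j < int p * int (p ^ f)"
          using x j by (auto simp: mod_kernel_def mod_vectors_def dims PiE_iff)
        then show ?thesis
          unfolding t using p0 by (simp add: zero_le_mult_iff)
      qed
      moreover have "[mat_apply M (?h x) i = 0] (mod int (p ^ f))" if "i < k" for i
      proof -
        have "mat_apply M x i = mat_apply M (\<lambda>j. int p * ?h x j) i"
          unfolding mat_apply_def dims by (intro sum.cong) (use dvd[OF x] in auto)
        then have eq: "mat_apply M x i = int p * mat_apply M (?h x) i"
          by (simp only: mat_apply_scale)
        have "int (p ^ Suc f) dvd mat_apply M x i"
          using x that by (simp add: mod_kernel_def dims cong_0_iff)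
        then have "int p * int (p ^ f) dvd int p * mat_apply M (?h x) i"
          unfolding eq by (simp only: power_Suc of_nat_mult)
        then show ?thesis using p0 by (simp add: cong_0_iff)
      qed
      ultimately show "?h x \<in> mod_kernel (p ^ f) M"
        by (simp add: mod_kernel_def mod_vectors_def dims)
    qed
    ultimately have "card (mod_kernel (p ^ Suc f) M) \<le> card (mod_kernel (p ^ f) M)"
      by (rule card_inj_on_le) simp
    then show False using card by simp
  qed
  then obtain x j where x: "x \<in> mod_kernel (p ^ Suc f) M" and j: "j < k" and nd: "\<not> int p dvd x j"
    by blast
  \<comment> \<open>The determinant annihilates the coordinate \<open>x j\<close>, which is a unit
    modulo \<open>p ^ Suc f\<close>.\<close>
  have "[det M * x j = 0] (mod int (p ^ Suc f))"
    using x by (intro det_times_kernel[OF M _ j]) (simp add: mod_kernel_def dims)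
  moreover have "coprime (int (p ^ Suc f)) (x j)"
    using p nd by (simp add: prime_imp_coprime del: power_Suc)
  ultimately show ?thesis
    by (simp add: cong_0_iff coprime_dvd_mult_left_iff del: power_Suc)
qed

text \<open>On the finite set of vectors modulo \<open>p\<close>, injectivity gives surjectivity.
  Preimages of the unit vectors are the columns of a matrix \<open>B\<close> with
  \<open>M * B\<close> congruent to the identity, so \<open>det M\<close> is a unit modulo
  \<open>p\<close>.\<close>

lemma prime_not_dvd_det_if_kernel_trivial:
  assumes p: "prime p" and M: "M \<in> carrier_mat k k"
    and trivial: "\<And>x. x \<in> mod_kernel p M \<Longrightarrow> \<forall>j<k. x j = 0"
  shows "\<not> int p dvd det M"
proof -
  have p0: "p > 0" using p prime_gt_0_nat by blast
  have dims: "dim_row M = k" "dim_col M = k" using M by auto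
  let ?V = "mod_vectors p k"
  let ?h = "\<lambda>x. vec_mod p k (mat_apply M x)"
  have "inj_on ?h ?V"
  proof (rule inj_onI)
    fix x y assume x: "x \<in> ?V" and y: "y \<in> ?V" and eq: "?h x = ?h y"
    let ?z = "vec_mod p k (\<lambda>j. x j - y j)"
    have "[mat_apply M ?z i = 0] (mod int p)" if i: "i < k" for i
    proof -
      have "[mat_apply M ?z i = mat_apply M (\<lambda>j. x j - y j) i] (mod int p)"
        by (intro mat_apply_cong vec_mod_cong) (simp add: dims)
      also have "mat_apply M (\<lambda>j. x j - y j) i = mat_apply M x i - mat_apply M y i"
        by (rule mat_apply_diff)
      also have "[\<dots> = ?h x i - ?h y i] (mod int p)"
        using i by (intro cong_diff cong_sym[OF vec_mod_cong])
      finally show ?thesis using eq by simp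
    qed
    then have "?z \<in> mod_kernel p M"
      using p0 by (simp add: mod_kernel_def vec_mod_in dims)
    then have "?z j = 0" if "j < k" for j using trivial that by blast
    then show "x = y"
    proof (intro mod_vectors_eqI[OF x y])
      fix j assume j: "j < k"
      have "[?z j = x j - y j] (mod int p)" by (rule vec_mod_cong[OF j])
      then show "[x j = y j] (mod int p)"
        using \<open>\<And>j. j < k \<Longrightarrow> ?z j = 0\<close>[OF j]
        by (simp add: cong_iff_dvd_diff dvd_diff_commute)
    qed
  qed
  moreover have "?h ` ?V \<subseteq> ?V" using p0 vec_mod_in by blast
  ultimately have surj: "?h ` ?V = ?V" by (intro endo_inj_surj) simp_all
  have "\<forall>l. \<exists>x. x \<in> ?V \<and> ?h x = vec_mod p k (\<lambda>i. if i = l then 1 else 0)"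
    using surj vec_mod_in[OF p0] by (metis (no_types, lifting) imageE)
  then obtain b where b: "b l \<in> ?V" "?h (b l) = vec_mod p k (\<lambda>i. if i = l then 1 else 0)" for l
    by metis
  define B where "B = mat k k (\<lambda>(j, l). b l j)"
  have B: "B \<in> carrier_mat k k" by (simp add: B_def)
  have "[det (M * B) = det (1\<^sub>m k)] (mod int p)"
  proof (rule det_cong)
    fix i l assume i: "i < k" and l: "l < k"
    have "(M * B) $$ (i, l) = mat_apply M (b l) i"
      using i l M by (auto simp: B_def scalar_prod_def mat_apply_def atLeast0LessThan intro!: sum.cong)
    also have "[\<dots> = ?h (b l) i] (mod int p)" using vec_mod_cong[OF i] by (rule cong_sym)
    also have "[?h (b l) i = (if i = l then 1 else 0)] (mod int p)"
      using vec_mod_cong[OF i] b(2) by metis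
    finally show "[(M * B) $$ (i, l) = 1\<^sub>m k $$ (i, l)] (mod int p)" using i l by simp
  qed (use M B in auto)
  then have "[det M * det B = 1] (mod int p)" by (simp add: det_mult[OF M B])
  then show ?thesis
    using p by (metis cong_dvd_iff dvd_mult2 not_prime_unit of_nat_1 int_dvd_int_iff nat_dvd_1_iff_1 prime_nat_iff)
qed

text \<open>The kernel has dimension at most one, so after deleting a suitable column \<open>j\<close> the matrix is
  injective modulo \<open>p\<close>. Replacing that column by a vector outside the image then gives an
  invertible matrix, which has the same cofactors along column \<open>j\<close>.\<close>

lemma cofactor_not_dvd:
  assumes p: "prime p" and M: "M \<in> carrier_mat k k" and k: "k > 0"
    and card: "card (mod_kernel p M) \<le> p"
  obtains i j where "i < k" "j < k" "\<not> int p dvd cofactor M i j"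
proof -
  have p0: "p > 0" using p prime_gt_0_nat by blast
  have dims: "dim_row M = k" "dim_col M = k" using M by auto
  let ?V = "mod_vectors p k"
  have prime: "prime (int p)" using p by simp
  have scale: "vec_mod p k (\<lambda>l. t * x l) \<in> mod_kernel p M" if "x \<in> mod_kernel p M" for x t
  proof -
    have "[mat_apply M (vec_mod p k (\<lambda>l. t * x l)) i = 0] (mod int p)" if i: "i < k" for i
    proof -
      have "[mat_apply M (vec_mod p k (\<lambda>l. t * x l)) i = t * mat_apply M x i] (mod int p)"
        unfolding mat_apply_scale[symmetric] by (intro mat_apply_cong vec_mod_cong) (simp add: dims)
      also have "[t * mat_apply M x i = t * 0] (mod int p)"
        using \<open>x \<in> _\<close> i by (intro cong_mult cong_refl) (simp add: mod_kernel_def dims)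
      finally show ?thesis by simp
    qed
    then show ?thesis using p0 by (simp add: mod_kernel_def vec_mod_in dims)
  qed
  have small: "0 \<le> x l" "x l < int p" if "x \<in> mod_kernel p M" "l < k" for x l
    using that by (auto simp: mod_kernel_def mod_vectors_def dims PiE_iff)
  \<comment> \<open>Take \<open>j\<close> where some kernel vector \<open>v\<close> is nonzero. The
    \<open>p\<close> multiples of \<open>v\<close> already fill the kernel, and among them only zero
    vanishes at \<open>j\<close>. If the kernel is trivial, any \<open>j\<close> will do.\<close>
  have "\<exists>j<k. \<forall>x\<in>mod_kernel p M. x j = 0 \<longrightarrow> (\<forall>l<k. x l = 0)"
  proof (cases "\<exists>v\<in>mod_kernel p M. \<exists>j<k. v j \<noteq> 0")
    case True
    then obtain v j where v: "v \<in> mod_kernel p M" and j: "j < k" "v j \<noteq> 0" by blast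
    have vj: "coprime (v j) (int p)"
    proof -
      have "\<not> int p dvd v j"
        using small[OF v j(1)] j(2) zdvd_imp_le[of "int p" "v j"] by force
      then show ?thesis using prime_imp_coprime[OF prime] coprime_commute by blast
    qed
    have "\<forall>l<k. x l = 0" if x: "x \<in> mod_kernel p M" "x j = 0" for x
    proof (rule ccontr)
      assume nz: "\<not> (\<forall>l<k. x l = 0)"
      let ?m = "\<lambda>t. vec_mod p k (\<lambda>l. t * v l)"
      have mj: "?m t j = t * v j mod int p" for t using j by (simp add: vec_mod_def)
      have inj: "inj_on ?m {0..<int p}"
      proof (rule inj_onI)
        fix s t assume st: "s \<in> {0..<int p}" "t \<in> {0..<int p}" "?m s = ?m t"
        then have "[s * v j = t * v j] (mod int p)"
          using arg_cong[OF st(3), of "\<lambda>g. g j"] unfolding mj by (simp add: cong_def)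
        then have "[s = t] (mod int p)"
          using vj by (simp add: cong_mult_rcancel)
        then show "s = t" using st by (simp add: cong_def)
      qed
      have "x \<notin> ?m ` {0..<int p}"
      proof
        assume "x \<in> ?m ` {0..<int p}"
        then obtain t where t: "t \<in> {0..<int p}" "x = ?m t" by blast
        then have "t * v j mod int p = 0" using x(2) mj[of t] by simp
        then have "int p dvd t * v j" by (rule mod_0_imp_dvd)
        then have "int p dvd t"
          using vj by (simp add: coprime_commute coprime_dvd_mult_left_iff)
        then have "t = 0" using t(1) zdvd_imp_le[of "int p" t] by force
        then show False using nz t(2) by (simp add: vec_mod_def)
      qed
      moreover have "insert x (?m ` {0..<int p}) \<subseteq> mod_kernel p M"
        using scale[OF v] x by blast
      then have "card (insert x (?m ` {0..<int p})) \<le> card (mod_kernel p M)"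
        by (intro card_mono) simp_all
      ultimately show False using card card_image[OF inj] by simp
    qed
    then show ?thesis using j by blast
  next
    case False
    then show ?thesis using k by blast
  qed
  then obtain j where j: "j < k"
    and determined: "\<And>x l. x \<in> mod_kernel p M \<Longrightarrow> x j = 0 \<Longrightarrow> l < k \<Longrightarrow> x l = 0"
    by blast
  let ?h = "\<lambda>x. vec_mod p k (mat_apply M x)"
  \<comment> \<open>Vectors whose entry \<open>j\<close> is omitted and then set to zero: there are
    only \<open>p ^ (k - 1)\<close>, too few for their images to cover all vectors modulo
    \<open>p\<close>.\<close>
  define U where "U = ({..<k} - {j}) \<rightarrow>\<^sub>E {0..<int p}"
  have "card (?h ` (\<lambda>x. x(j := 0)) ` U) \<le> card U"
    unfolding image_image by (rule card_image_le) (simp add: U_def finite_PiE)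
  also have "\<dots> = p ^ (k - 1)" using j by (simp add: U_def card_PiE)
  also have "\<dots> < p ^ k" using prime_gt_1_nat[OF p] k by (intro power_strict_increasing) simp_all
  finally have less: "card (?h ` (\<lambda>x. x(j := 0)) ` U) < p ^ k" .
  have "\<not> ?V \<subseteq> ?h ` (\<lambda>x. x(j := 0)) ` U"
  proof
    assume "?V \<subseteq> ?h ` (\<lambda>x. x(j := 0)) ` U"
    then have "card ?V \<le> card (?h ` (\<lambda>x. x(j := 0)) ` U)"
      by (rule card_mono[rotated]) (simp add: U_def finite_PiE)
    then show False using less by simp
  qed
  then obtain u where u: "u \<in> ?V" "u \<notin> ?h ` (\<lambda>x. x(j := 0)) ` U" by blast
  have outside: False
    if hx: "\<And>i. i < k \<Longrightarrow> [mat_apply M x i = u i] (mod int p)" and x: "x j = 0" for x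
  proof -
    let ?x = "\<lambda>l\<in>{..<k} - {j}. x l mod int p"
    have "?x \<in> U" using p0 by (simp add: U_def)
    have "[(?x(j := 0)) l = x l] (mod int p)" if "l < k" for l
      using x that by (simp add: cong_def)
    then have "[mat_apply M (?x(j := 0)) i = mat_apply M x i] (mod int p)" for i
      by (intro mat_apply_cong) (simp add: dims)
    then have "?h (?x(j := 0)) = u"
      using hx
      by (intro mod_vectors_eqI[OF vec_mod_in[OF p0] u(1)])
        (blast intro: cong_trans[OF vec_mod_cong] cong_trans)
    then show False using u(2) \<open>?x \<in> U\<close> by blast
  qed
  define M' where "M' = mat k k (\<lambda>(i, l). if l = j then u i else M $$ (i, l))"
  have M': "M' \<in> carrier_mat k k" by (simp add: M'_def)
  have split: "mat_apply M' x i = mat_apply M (x(j := 0)) i + x j * u i" if "i < k" for x i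
  proof -
    have "mat_apply M' x i = (\<Sum>l<k. M $$ (i, l) * (x(j := 0)) l + (if l = j then x j * u i else 0))"
      using that unfolding mat_apply_def by (intro sum.cong) (auto simp: M'_def)
    then show ?thesis using j by (simp add: sum.distrib mat_apply_def dims)
  qed
  have "\<not> int p dvd det M'"
  proof (rule prime_not_dvd_det_if_kernel_trivial[OF p M'])
    fix x assume x: "x \<in> mod_kernel p M'"
    have ker: "[mat_apply M (x(j := 0)) i + x j * u i = 0] (mod int p)" if "i < k" for i
      using x split that by (simp add: mod_kernel_def M'_def)
    have xV: "x \<in> ?V" using x by (simp add: mod_kernel_def M'_def)
    then have xj: "0 \<le> x j" "x j < int p" using j by (auto simp: mod_vectors_def PiE_iff)
    have "x j = 0"
    proof (rule ccontr)
      assume "x j \<noteq> 0"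
      then have "coprime (x j) (int p)"
        using xj prime_imp_coprime[OF prime, of "x j"] coprime_commute
          zdvd_imp_le[of "int p" "x j"] by force
      then obtain r where r: "[x j * r = 1] (mod int p)"
        using cong_solve_coprime_int by blast
      show False
      proof (rule outside)
        fix i assume i: "i < k"
        \<comment> \<open>With \<open>x j\<close> invertible, the kernel relation of
          \<open>M'\<close> can be solved for \<open>u\<close>, which would make \<open>u\<close>
          the image of a vector vanishing at \<open>j\<close>.\<close>
        have "mat_apply M (\<lambda>l. (- r) * (x(j := 0)) l) i =
            (x j * r) * u i - r * (mat_apply M (x(j := 0)) i + x j * u i)"
          unfolding mat_apply_scale by (simp only: algebra_simps)
        also have "[\<dots> = 1 * u i - r * 0] (mod int p)"
          using r ker[OF i] by (intro cong_diff cong_mult cong_refl)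
        finally show "[mat_apply M (\<lambda>l. (- r) * (x(j := 0)) l) i = u i] (mod int p)"
          by (simp only: mult_1 mult_zero_right diff_zero)
      qed simp
    qed
    then have "x(j := 0) = x" by auto
    then have "x \<in> mod_kernel p M"
      using ker xV \<open>x j = 0\<close> by (simp add: mod_kernel_def dims)
    then show "\<forall>l<k. x l = 0" using determined \<open>x j = 0\<close> by blast
  qed
  moreover have "det M' = (\<Sum>i<k. M' $$ (i, j) * cofactor M i j)"
  proof -
    have "mat_delete M' i j = mat_delete M i j" if "i < k" for i
      using that j M by (intro eq_matI) (auto simp: mat_delete_def M'_def)
    then show ?thesis
      unfolding laplace_expansion_column[OF M' j] cofactor_def by (intro sum.cong) simp_all
  qed
  ultimately obtain i where "i < k" "\<not> int p dvd cofactor M i j"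
    by (metis (no_types, lifting) dvd_mult dvd_sum lessThan_iff)
  then show thesis using j that by blast
qed

text \<open>Since \<open>M * adj_mat M\<close> is \<open>det M\<close> times the identity, every
  column of the adjugate lies in the kernel modulo \<open>p ^ f\<close>. A column containing a
  cofactor prime to \<open>p\<close> has \<open>p ^ f\<close> distinct multiples.\<close>

lemma prime_power_dvd_card_kernel:
  assumes p: "prime p" and M: "M \<in> carrier_mat k k"
    and card: "card (mod_kernel p M) \<le> p"
    and dvd: "int (p ^ f) dvd det M"
  shows "p ^ f \<le> card (mod_kernel (p ^ f) M)"
proof (cases "f = 0 \<or> k = 0")
  case True
  have "mod_kernel (p ^ f) M \<noteq> {} "
  proof -
    have "(\<lambda>j\<in>{..<k}. 0) \<in> mod_kernel (p ^ f) M"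
      using M p prime_gt_0_nat by (auto simp: mod_kernel_def mod_vectors_def mat_apply_def)
    then show ?thesis by blast
  qed
  then have "card (mod_kernel (p ^ f) M) > 0" by (simp add: card_gt_0_iff)
  \<comment> \<open>For \<open>k = 0\<close> the determinant is 1, and the divisibility hypothesis
    leaves no other possibility.\<close>
  moreover have "p ^ f = 1"
  proof (cases "f = 0")
    case False
    then have "det M = 1" using True M by simp
    then show ?thesis
      using dvd int_dvd_int_iff[of "p ^ f" 1] by (simp del: of_nat_power)
  qed simp
  ultimately show ?thesis by linarith
next
  case False
  have p0: "p > 0" using p prime_gt_0_nat by blast
  have dims: "dim_row M = k" "dim_col M = k" using M by auto
  obtain i j where ij: "i < k" "j < k" "\<not> int p dvd cofactor M i j"
    using cofactor_not_dvd[OF p M _ card] False by blast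
  \<comment> \<open>Column \<open>i\<close> of the adjugate; because of the transposition its entry
    \<open>j\<close> is \<open>cofactor M i j\<close>.\<close>
  define v where "v = (\<lambda>l. adj_mat M $$ (l, i))"
  have Mv: "[mat_apply M v l = 0] (mod int (p ^ f))" if l: "l < k" for l
  proof -
    have "mat_apply M v l = (M * adj_mat M) $$ (l, i)"
      using l ij adj_mat(1)[OF M] M
      by (auto simp: mat_apply_def v_def scalar_prod_def atLeast0LessThan intro!: sum.cong)
    also have "\<dots> = det M * (1\<^sub>m k $$ (l, i))"
      using l ij by (simp add: adj_mat(2)[OF M])
    finally show ?thesis using dvd by (simp add: cong_0_iff)
  qed
  have vj: "coprime (v j) (int (p ^ f))"
    using p ij M prime_imp_coprime[of "int p" "v j"] by (simp add: v_def adj_mat_def coprime_commute)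
  let ?m = "\<lambda>t. vec_mod (p ^ f) k (\<lambda>l. t * v l)"
  have "inj_on ?m {0..<int (p ^ f)}"
  proof (rule inj_onI)
    fix s t assume st: "s \<in> {0..<int (p ^ f)}" "t \<in> {0..<int (p ^ f)}" "?m s = ?m t"
    have "[s * v j = ?m s j] (mod int (p ^ f))"
      by (rule cong_sym[OF vec_mod_cong[OF ij(2)]])
    also have "?m s j = ?m t j" using st by simp
    also have "[?m t j = t * v j] (mod int (p ^ f))"
      by (rule vec_mod_cong[OF ij(2)])
    finally have "[s * v j = t * v j] (mod int (p ^ f))" .
    then have "[s = t] (mod int (p ^ f))"
      using vj by (simp add: cong_mult_rcancel del: of_nat_power)
    then show "s = t" using st by (simp add: cong_def del: of_nat_power)
  qed
  moreover have "?m ` {0..<int (p ^ f)} \<subseteq> mod_kernel (p ^ f) M"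
  proof (rule image_subsetI)
    fix t
    have "[mat_apply M (?m t) l = 0] (mod int (p ^ f))" if l: "l < k" for l
    proof -
      have "[mat_apply M (?m t) l = t * mat_apply M v l] (mod int (p ^ f))"
        unfolding mat_apply_scale[symmetric] by (intro mat_apply_cong vec_mod_cong) (simp add: dims)
      also have "[t * mat_apply M v l = t * 0] (mod int (p ^ f))"
        by (intro cong_mult cong_refl Mv l)
      finally show ?thesis by simp
    qed
    then show "?m t \<in> mod_kernel (p ^ f) M"
      using p0 by (simp add: mod_kernel_def vec_mod_in dims)
  qed
  ultimately have "card {0..<int (p ^ f)} \<le> card (mod_kernel (p ^ f) M)"
    by (rule card_inj_on_le) simp
  then show ?thesis by (simp del: of_nat_power)
qed

lemma int_dvd_by_prime_powers:
  fixes a b :: int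
  assumes "a \<noteq> 0" "\<And>p f. prime p \<Longrightarrow> int (p ^ f) dvd a \<Longrightarrow> int (p ^ f) dvd b"
  shows "a dvd b"
proof (cases "b = 0")
  case False
  show ?thesis
  proof (rule multiplicity_le_imp_dvd)
    fix p :: int assume p: "prime p"
    then have np: "prime (nat p)" "int (nat p) = p"
      using iffD1[OF prime_int_nat_transfer p] by simp_all
    have "int (nat p ^ multiplicity p a) dvd b"
      using multiplicity_dvd[of p a] by (intro assms(2) np(1)) (simp only: of_nat_power np(2))
    then have "p ^ multiplicity p a dvd b" by (simp only: of_nat_power np(2))
    then show "multiplicity p a \<le> multiplicity p b"
      using False p not_prime_unit by (intro multiplicity_geI) auto
  qed fact
qed simp

text \<open>It is enough to compare prime powers \<open>p ^ f\<close> dividing \<open>n\<close>. If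
  \<open>p ^ f\<close> divides \<open>a\<close>, the kernel grows from at most
  \<open>p ^ (f - 1)\<close> to exactly \<open>p ^ f\<close> elements at the last step. If
  \<open>p ^ f\<close> divides the determinant, the count modulo \<open>p\<close> bounds the kernel
  by \<open>p\<close>, so the count modulo \<open>p ^ f\<close> is at least \<open>p ^ f\<close>;
  being \<open>gcd a (p ^ f)\<close>, it equals \<open>p ^ f\<close>.\<close>

theorem gcd_det_eq_if_card_kernels:
  assumes M: "M \<in> carrier_mat k k" and n: "n > 0"
    and card: "\<And>d. d dvd n \<Longrightarrow> int (card (mod_kernel d M)) = gcd a (int d)"
  shows "gcd (det M) (int n) = gcd a (int n)"
proof (rule zdvd_antisym_nonneg)
  have prime_power: "int (p ^ f) dvd det M \<longleftrightarrow> int (p ^ f) dvd a"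
    if p: "prime p" and dvd: "p ^ f dvd n" for p f
  proof (cases f)
    case (Suc e)
    have "p * p ^ e dvd n" using dvd Suc by simp
    then have e: "p ^ e dvd n" and p1: "p dvd n"
      using dvd_mult_right dvd_mult_left by blast+
    show ?thesis
    proof
      assume "int (p ^ f) dvd a"
      then have "card (mod_kernel (p ^ f) M) = p ^ f"
        using card[OF dvd] by (simp add: gcd_proj2_if_dvd del: of_nat_power)
      moreover have "card (mod_kernel (p ^ e) M) \<le> p ^ e"
      proof -
        have "gcd a (int (p ^ e)) \<le> int (p ^ e)"
          using p prime_gt_0_nat by (intro gcd_le2_int) simp
        then show ?thesis using card[OF e] by linarith
      qed
      moreover have "p ^ e < p ^ f" using Suc prime_gt_1_nat[OF p] by (simp only: power_strict_increasing_iff lessI)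
      ultimately show "int (p ^ f) dvd det M"
        using prime_power_dvd_det[OF p M, of e] unfolding Suc[symmetric] by simp
    next
      assume "int (p ^ f) dvd det M"
      moreover have "gcd a (int p) \<le> int p"
        using p prime_gt_0_nat by (intro gcd_le2_int) simp
      then have "card (mod_kernel p M) \<le> p" using card[OF p1] by linarith
      ultimately have "p ^ f \<le> card (mod_kernel (p ^ f) M)"
        by (intro prime_power_dvd_card_kernel[OF p M])
      then have "int (p ^ f) \<le> gcd a (int (p ^ f))"
        using card[OF dvd] by linarith
      moreover have "gcd a (int (p ^ f)) \<le> int (p ^ f)"
        using p prime_gt_0_nat by (intro gcd_le2_int) simp
      ultimately show "int (p ^ f) dvd a" by (metis gcd_dvd1 order_antisym)
    qed
  qed simp
  have divides: "gcd b (int n) dvd gcd c (int n)"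
    if "\<And>p f. prime p \<Longrightarrow> p ^ f dvd n \<Longrightarrow> int (p ^ f) dvd b \<Longrightarrow> int (p ^ f) dvd c" for b c
  proof (rule int_dvd_by_prime_powers)
    show "gcd b (int n) \<noteq> 0" using n by simp
    fix p f assume p: "prime p" "int (p ^ f) dvd gcd b (int n)"
    then have "int (p ^ f) dvd b" "int (p ^ f) dvd int n" by (meson dvd_trans gcd_dvd1 gcd_dvd2)+
    then show "int (p ^ f) dvd gcd c (int n)"
      using that[OF p(1)] by (intro gcd_greatest) (simp_all only: int_dvd_int_iff)
  qed
  show "gcd (det M) (int n) dvd gcd a (int n)" "gcd a (int n) dvd gcd (det M) (int n)"
    using prime_power by (intro divides; blast)+
qed simp_all

section \<open>Planarity and the redundant relation\<close>

text \<open>Seen from the strand through passage \<open>i\<close>, the other strand of this crossing runs from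
  right to left.\<close>

definition crossed_leftwards :: "gauss_code \<Rightarrow> nat \<Rightarrow> bool" where
  "crossed_leftwards w i \<longleftrightarrow> (level (w ! i) = Over \<longleftrightarrow> csign (w ! i) = Pos)"

definition partner :: "gauss_code \<Rightarrow> nat \<Rightarrow> nat" where
  "partner w i = passage_index w (other_level (level (w ! i))) (crossing (w ! i))"

text \<open>Edge \<open>i\<close> leaves passage \<open>i\<close>, so this is the edge that arrives
  at passage \<open>i\<close>. Adding the length first avoids truncated subtraction at 0.\<close>

definition prev_edge :: "gauss_code \<Rightarrow> nat \<Rightarrow> nat" where
  "prev_edge w i = (i + length w - 1) mod length w"

lemma prev_edge_less: "i < length w \<Longrightarrow> prev_edge w i < length w"
  by (cases "w = []") (simp_all add: prev_edge_def)

lemma Suc_prev_edge: "i < length w \<Longrightarrow> Suc (prev_edge w i) mod length w = i"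
  by (cases i) (simp_all add: prev_edge_def mod_Suc)

lemma prev_edge_Suc: "i < length w \<Longrightarrow> prev_edge w (Suc i mod length w) = i"
  by (cases "Suc i = length w") (auto simp: prev_edge_def)

lemma prev_edge_Suc': "Suc i < length w \<Longrightarrow> prev_edge w (Suc i) = i"
  by (simp add: prev_edge_def)

lemma bij_betw_prev_edge: "bij_betw (prev_edge w) {..<length w} {..<length w}"
  by (rule bij_betw_byWitness[where f' = "\<lambda>i. Suc i mod length w"])
    (auto simp: Suc_prev_edge prev_edge_Suc prev_edge_less intro!: mod_less_divisor)

lemma other_other_level [simp]: "other_level (other_level l) = l"
  by (cases l) simp_all

section \<open>The faces around a crossing\<close>

context
  fixes w :: gauss_code
  assumes wf: "well_formed w"
begin

lemma partner:
  assumes i: "i < length w"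
  shows partner_less: "partner w i < length w"
    and level_partner: "level (w ! partner w i) = other_level (level (w ! i))"
    and crossing_partner: "crossing (w ! partner w i) = crossing (w ! i)"
    and partner_partner: "partner w (partner w i) = i"
    and crossed_leftwards_partner: "crossed_leftwards w (partner w i) \<longleftrightarrow> \<not> crossed_leftwards w i"
proof -
  have "crossing (w ! i) \<in> crossings w" using i by (simp add: crossings_def)
  note p = passage_index[OF wf this]
  show less: "partner w i < length w" and lev: "level (w ! partner w i) = other_level (level (w ! i))"
    and c: "crossing (w ! partner w i) = crossing (w ! i)"
    using p by (simp_all add: partner_def)
  show "partner w (partner w i) = i"
    using passage_index_nth[OF wf i] by (simp add: partner_def[of w "partner w i"] lev c)
  have "csign (w ! partner w i) = csign (w ! i)"
    using csign_eq[OF wf] less i c by simp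
  then show "crossed_leftwards w (partner w i) \<longleftrightarrow> \<not> crossed_leftwards w i"
    using lev by (cases "level (w ! i)") (simp_all add: crossed_leftwards_def)
qed

text \<open>The four corners of a crossing. The strand through \<open>k\<close> runs from right to
  left across the strand through \<open>i\<close>, and each of the four darts arriving at the
  crossing is continued by the dart leaving to its left.\<close>

lemma left_turn_strands:
  assumes i: "i < length w" and X: "crossed_leftwards w i"
  defines "k \<equiv> partner w i"
  shows "left_turn w (prev_edge w i, True) = (k, True)"
    and "left_turn w (i, False) = (prev_edge w k, False)"
    and "left_turn w (prev_edge w k, True) = (prev_edge w i, False)"
    and "left_turn w (k, False) = (i, True)"
proof -
  note k = partner[OF i, folded k_def]
  have Xk: "\<not> crossed_leftwards w k" using k(5) X by simp
  have pk: "passage_index w (other_level (level (w ! k))) (crossing (w ! k)) = i"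
    using k(4) by (simp add: partner_def)
  have pi: "passage_index w (other_level (level (w ! i))) (crossing (w ! i)) = k"
    by (simp add: k_def partner_def)
  show "left_turn w (prev_edge w i, True) = (k, True)"
    using X i by (simp add: Let_def Suc_prev_edge pi crossed_leftwards_def)
  show "left_turn w (i, False) = (prev_edge w k, False)"
    using X by (simp add: Let_def pi crossed_leftwards_def prev_edge_def)
  show "left_turn w (prev_edge w k, True) = (prev_edge w i, False)"
    using Xk k(1) by (simp add: Let_def Suc_prev_edge pk crossed_leftwards_def prev_edge_def[of w i])
  show "left_turn w (k, False) = (i, True)"
    using Xk by (simp add: Let_def pk crossed_leftwards_def)
qed

text \<open>Exactly one of the two passages through a crossing is crossed leftwards, so every
  crossing can be viewed in the position of \<open>left_turn_strands\<close>.\<close>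

lemma crossed_leftwards_cases:
  assumes "i < length w"
  obtains "crossed_leftwards w i"
  | j where "j < length w" "crossed_leftwards w j" "i = partner w j"
proof (cases "crossed_leftwards w i")
  case True
  then show thesis by (rule that(1))
next
  case False
  then show thesis
    using that(2)[OF partner_less[OF assms] _ partner_partner[OF assms, symmetric]]
      crossed_leftwards_partner[OF assms] by blast
qed

lemma dart_in_image:
  assumes j: "j < length w"
  shows "(j, b) \<in> left_turn w ` ({..<length w} \<times> UNIV)"
proof (cases b)
  case True
  from j show ?thesis
  proof (cases rule: crossed_leftwards_cases)
    case 1
    then show ?thesis
      using left_turn_strands(4)[OF j 1] partner_less[OF j] True
      by (intro image_eqI[of _ _ "(partner w j, False)"]) simp_all
  next
    case (2 i)
    then show ?thesis
      using left_turn_strands(1)[OF 2(1,2)] prev_edge_less[OF 2(1)] True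
      by (intro image_eqI[of _ _ "(prev_edge w i, True)"]) simp_all
  qed
next
  case False
  \<comment> \<open>Traversed backwards, edge \<open>j\<close> is a dart leaving the passage at
    which the edge ends.\<close>
  define j' where "j' = Suc j mod length w"
  have j': "j' < length w" "j = prev_edge w j'"
    using j prev_edge_Suc[OF j] by (auto simp: j'_def intro!: mod_less_divisor)
  from j'(1) show ?thesis
  proof (cases rule: crossed_leftwards_cases)
    case 1
    then show ?thesis
      using left_turn_strands(3)[OF j'(1) 1] partner_less[OF j'(1)] False j' prev_edge_less
      by (intro image_eqI[of _ _ "(prev_edge w (partner w j'), True)"]) simp_all
  next
    case (2 i)
    then show ?thesis
      using left_turn_strands(2)[OF 2(1,2)] False j'
      by (intro image_eqI[of _ _ "(i, False)"]) simp_all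
  qed
qed

text \<open>\<open>orbit\<close> collects only proper iterates, so a dart belongs to its own orbit
  only because \<open>left_turn\<close> permutes the darts, which follows from surjectivity on a
  finite set.\<close>

lemma orbit_left_turn_step:
  assumes d: "d \<in> {..<length w} \<times> UNIV"
  shows "orbit (left_turn w) (left_turn w d) = orbit (left_turn w) d"
proof -
  let ?D = "{..<length w} \<times> (UNIV :: bool set)"
  have fin: "finite ?D" by simp
  have sub: "?D \<subseteq> left_turn w ` ?D" using dart_in_image by auto
  then have inj: "inj_on (left_turn w) ?D"
    by (rule finite_surj_inj[OF fin])
  have img: "left_turn w ` ?D = ?D"
    using sub card_image[OF inj] by (metis card_subset_eq fin finite_imageI)
  \<comment> \<open>Extended by the identity off the darts, as \<open>permutes\<close> demands of a
    total function.\<close>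
  define g where "g = (\<lambda>d. if d \<in> ?D then left_turn w d else d)"
  have "bij_betw (left_turn w) ?D ?D" using inj img by (simp add: bij_betw_def)
  moreover have "bij_betw g ?D ?D \<longleftrightarrow> bij_betw (left_turn w) ?D ?D"
    by (rule bij_betw_cong) (simp add: g_def)
  ultimately have "bij_betw g ?D ?D" by simp
  then have "g permutes ?D"
    by (rule bij_imp_permutes) (simp add: g_def)
  then have "permutation g"
    using fin by (metis permutation_permutes)
  then have "d \<in> orbit g d" by (rule permutation_self_in_orbit)
  moreover have "orbit g d = orbit (left_turn w) d"
  proof (rule orbit_cong0[OF d])
    show "g \<in> ?D \<rightarrow> ?D" using img unfolding g_def by (intro Pi_I) (metis imageI)
    show "g y = left_turn w y" if "y \<in> ?D" for y using that by (simp add: g_def)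
  qed
  ultimately show ?thesis by (simp add: self_in_orbit_step)
qed

text \<open>Turning left keeps the traced face on the left, so \<open>a i\<close> and
  \<open>b i\<close> are the values on the faces to the left and to the right of edge
  \<open>i\<close>. Each equation says that one corner of the crossing lies in a single
  face.\<close>

lemma face_relations:
  fixes a b :: "nat \<Rightarrow> 'a"
  assumes a: "\<And>i. i < length w \<Longrightarrow> a i = phi (orbit (left_turn w) (i, True))"
    and b: "\<And>i. i < length w \<Longrightarrow> b i = phi (orbit (left_turn w) (i, False))"
    and i: "i < length w" "crossed_leftwards w i"
  shows "a (prev_edge w i) = a (partner w i)" "b i = b (prev_edge w (partner w i))"
    "a (prev_edge w (partner w i)) = b (prev_edge w i)" "b (partner w i) = a i"
proof -
  have step: "orbit (left_turn w) (left_turn w (j, e)) = orbit (left_turn w) (j, e)"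
    if "j < length w" for j e
    by (rule orbit_left_turn_step) (simp add: that)
  note k = partner_less[OF i(1)]
  note pi = prev_edge_less[OF i(1)] and pk = prev_edge_less[OF k]
  show "a (prev_edge w i) = a (partner w i)"
    unfolding a[OF pi] a[OF k] using step[OF pi, of True] left_turn_strands(1)[OF i] by metis
  show "b i = b (prev_edge w (partner w i))"
    unfolding b[OF i(1)] b[OF pk] using step[OF i(1), of False] left_turn_strands(2)[OF i] by metis
  show "a (prev_edge w (partner w i)) = b (prev_edge w i)"
    unfolding a[OF pk] b[OF pi] using step[OF pk, of True] left_turn_strands(3)[OF i] by metis
  show "b (partner w i) = a i"
    unfolding a[OF i(1)] b[OF k] using step[OF k, of False] left_turn_strands(4)[OF i] by metis
qed

section \<open>Numberings of the faces\<close>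

lemma constant_along_knot:
  fixes f :: "nat \<Rightarrow> int"
  assumes "\<And>i. i < length w \<Longrightarrow> [f i = f (prev_edge w i)] (mod e)" "i < length w"
  shows "[f i = f 0] (mod e)"
  using assms(2)
proof (induction i)
  case (Suc i)
  then have "[f (Suc i) = f i] (mod e)"
    using assms(1)[of "Suc i"] by (simp add: prev_edge_Suc')
  moreover have "[f i = f 0] (mod e)" using Suc by simp
  ultimately show ?case by (rule cong_trans)
qed simp

text \<open>The jumps of \<open>a - b\<close> at the two passages through a crossing cancel. Hence, if the jumps at
  the over-passages vanish, \<open>a - b\<close> is constant along the knot.\<close>

lemma potential_difference_constant:
  fixes a b :: "nat \<Rightarrow> int"
  assumes rel: "\<And>i. i < length w \<Longrightarrow> crossed_leftwards w i \<Longrightarrow>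
      [a (prev_edge w i) = a (partner w i)] (mod e) \<and> [b i = b (prev_edge w (partner w i))] (mod e) \<and>
      [a (prev_edge w (partner w i)) = b (prev_edge w i)] (mod e) \<and> [b (partner w i) = a i] (mod e)"
    and over: "\<And>i. i < length w \<Longrightarrow> level (w ! i) = Over \<Longrightarrow>
      [a i - b i = a (prev_edge w i) - b (prev_edge w i)] (mod e)"
    and i: "i < length w"
  shows "[a i - b i = a 0 - b 0] (mod e)"
proof -
  let ?J = "\<lambda>j. (a j - b j) - (a (prev_edge w j) - b (prev_edge w j))"
  have cancel: "e dvd ?J j + ?J (partner w j)" if j: "j < length w" "crossed_leftwards w j" for j
  proof -
    let ?k = "partner w j"
    have "e dvd (a (prev_edge w j) - a ?k) + (b j - b (prev_edge w ?k)) +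
        (a (prev_edge w ?k) - b (prev_edge w j)) + (b ?k - a j)"
      using rel[OF j] by (intro dvd_add) (simp_all add: cong_iff_dvd_diff)
    also have "\<dots> = - (?J j + ?J ?k)" by simp
    finally show ?thesis by (simp only: dvd_minus_iff)
  qed
  have jump: "[a j - b j = a (prev_edge w j) - b (prev_edge w j)] (mod e)" if j: "j < length w" for j
  proof (cases "level (w ! j)")
    case Over
    then show ?thesis using over j by simp
  next
    case Under
    let ?k = "partner w j"
    have "level (w ! ?k) = Over" using level_partner[OF j] Under by simp
    then have k: "e dvd ?J ?k"
      using over[OF partner_less[OF j]] by (simp add: cong_iff_dvd_diff)
    have "e dvd ?J j + ?J ?k"
    proof (cases "crossed_leftwards w j")
      case False
      then have "crossed_leftwards w ?k" using crossed_leftwards_partner[OF j] by simp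
      from cancel[OF partner_less[OF j] this] show ?thesis
        unfolding partner_partner[OF j] by (simp only: add.commute)
    qed (rule cancel[OF j])
    then show ?thesis
      using k unfolding cong_iff_dvd_diff by (metis dvd_add_left_iff)
  qed
  then show ?thesis by (rule constant_along_knot[OF _ i])
qed

text \<open>This is the Alexander numbering modulo \<open>e\<close>: the left side of each edge has
  a number one higher than the right side. A function on the faces is determined by its value left
  of edge 0, its difference across edge 0 and the jumps of this difference at the over-passages.
  With \<open>N + 2\<close> faces there are as many functions as such data, so every choice of data
  occurs, in particular difference 1 without jumps.\<close>

lemma exists_face_numbering:
  assumes planar: "card (faces w) = card (crossings w) + 2" and nonempty: "w \<noteq> []" and e: "e > 0"
  obtains a b :: "nat \<Rightarrow> int" where
    "\<And>i. i < length w \<Longrightarrow> a i \<in> {0..<int e}"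
    "\<And>i. i < length w \<Longrightarrow> [a i - b i = 1] (mod int e)"
    "\<And>i. i < length w \<Longrightarrow> crossed_leftwards w i \<Longrightarrow>
      a (prev_edge w i) = a (partner w i) \<and> b i = b (prev_edge w (partner w i)) \<and>
      a (prev_edge w (partner w i)) = b (prev_edge w i) \<and> b (partner w i) = a i"
proof -
  let ?Z = "{0..<int e}" and ?C = "crossings w"
  let ?a = "\<lambda>phi i. phi (orbit (left_turn w) (i, True)) :: int"
  let ?b = "\<lambda>phi i. phi (orbit (left_turn w) (i, False)) :: int"
  let ?d = "\<lambda>phi i. ?a phi i - ?b phi i"
  let ?o = "passage_index w Over"
  define F where "F = (\<lambda>phi. (?a phi 0, ?d phi 0 mod int e,
      \<lambda>c\<in>?C. (?d phi (?o c) - ?d phi (prev_edge w (?o c))) mod int e))"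
  let ?dom = "faces w \<rightarrow>\<^sub>E ?Z"
  let ?cod = "?Z \<times> ?Z \<times> (?C \<rightarrow>\<^sub>E ?Z)"
  have finC: "finite ?C" by (simp add: crossings_def)
  have finF: "finite (faces w)" by (simp add: faces_def)
  have face: "orbit (left_turn w) (i, s) \<in> faces w" if "i < length w" for i s
    using that by (simp add: faces_def)
  have rel: "?a phi (prev_edge w i) = ?a phi (partner w i)"
    "?b phi i = ?b phi (prev_edge w (partner w i))"
    "?a phi (prev_edge w (partner w i)) = ?b phi (prev_edge w i)"
    "?b phi (partner w i) = ?a phi i"
    if "i < length w" "crossed_leftwards w i" for phi :: "_ \<Rightarrow> int" and i
    using face_relations[of "?a phi" phi "?b phi" i] that by auto
  have over: "?o (crossing (w ! i)) = i" "crossing (w ! i) \<in> ?C"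
    if "i < length w" "level (w ! i) = Over" for i
    using passage_index_nth[OF wf that(1)] that by (auto simp: crossings_def)
  have "inj_on F ?dom"
  proof (rule inj_onI)
    fix phi psi assume phi: "phi \<in> ?dom" and psi: "psi \<in> ?dom" and eq: "F phi = F psi"
    define a where "a = (\<lambda>i. ?a phi i - ?a psi i)"
    define b where "b = (\<lambda>i. ?b phi i - ?b psi i)"
    have r: "a (prev_edge w i) = a (partner w i)" "b i = b (prev_edge w (partner w i))"
      "a (prev_edge w (partner w i)) = b (prev_edge w i)" "b (partner w i) = a i"
      if "i < length w" "crossed_leftwards w i" for i
      unfolding a_def b_def using rel[OF that, of phi] rel[OF that, of psi] by presburger+
    have "[a i - b i = a 0 - b 0] (mod int e)" if i: "i < length w" for i
    proof (rule potential_difference_constant[OF _ _ i])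
      fix j assume j: "j < length w" "level (w ! j) = Over"
      have "(\<lambda>c\<in>?C. (?d phi (?o c) - ?d phi (prev_edge w (?o c))) mod int e) =
         (\<lambda>c\<in>?C. (?d psi (?o c) - ?d psi (prev_edge w (?o c))) mod int e)"
        using eq unfolding F_def by blast
      from fun_cong[OF this, of "crossing (w ! j)"]
      have "[?d phi j - ?d phi (prev_edge w j) = ?d psi j - ?d psi (prev_edge w j)] (mod int e)"
        using over[OF j] by (simp add: cong_def)
      then show "[a j - b j = a (prev_edge w j) - b (prev_edge w j)] (mod int e)"
        unfolding a_def b_def cong_iff_dvd_diff by (simp add: algebra_simps)
    qed (use r in simp)
    moreover have "[?d phi 0 = ?d psi 0] (mod int e)"
      using eq unfolding F_def cong_def by blast
    then have "[a 0 - b 0 = 0] (mod int e)"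
      unfolding a_def b_def cong_iff_dvd_diff by (simp add: algebra_simps)
    ultimately have "[a i - b i = 0] (mod int e)" if "i < length w" for i
      using that by (blast intro: cong_trans)
    then have ab: "[a i = b i] (mod int e)" if "i < length w" for i
      using that by (simp add: cong_iff_dvd_diff)
    \<comment> \<open>Once the two sides of every edge agree, the corner relations carry the common
      value through each crossing; it is constant along the knot and zero at edge 0.\<close>
    have "[a i = a (prev_edge w i)] (mod int e)" if i: "i < length w" for i
      using i
    proof (cases rule: crossed_leftwards_cases)
      case 1
      then show ?thesis using r[OF i] ab[OF partner_less[OF i]] by (simp add: cong_sym)
    next
      case (2 j)
      then show ?thesis
        using r[OF 2(1,2)] ab[OF prev_edge_less[OF 2(1)]] by simp
    qed
    then have const: "[a i = a 0] (mod int e)" if "i < length w" for i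
      by (rule constant_along_knot[OF _ that])
    have "?a phi 0 = ?a psi 0" using eq unfolding F_def by blast
    then have "a 0 = 0" by (simp add: a_def)
    have zero: "phi (orbit (left_turn w) (i, s)) = psi (orbit (left_turn w) (i, s))"
      if i: "i < length w" for i s
    proof -
      have "[a i = 0] (mod int e)" "[b i = 0] (mod int e)"
        using const[OF i] cong_trans[OF cong_sym[OF ab[OF i]] const[OF i]] \<open>a 0 = 0\<close> by simp_all
      then have "[?a phi i = ?a psi i] (mod int e)" "[?b phi i = ?b psi i] (mod int e)"
        by (simp_all add: a_def b_def cong_iff_dvd_diff)
      moreover have "phi (orbit (left_turn w) (i, s)) \<in> ?Z" "psi (orbit (left_turn w) (i, s)) \<in> ?Z" for s
        using phi psi face[OF i] by (blast intro: PiE_mem)+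
      ultimately show ?thesis by (cases s) (simp_all add: cong_def)
    qed
    show "phi = psi"
    proof (rule PiE_ext[OF phi psi])
      fix f assume "f \<in> faces w"
      then show "phi f = psi f" using zero by (auto simp: faces_def)
    qed
  qed
  then have "card (F ` ?dom) = card ?dom" by (rule card_image)
  moreover have "card ?dom = card ?cod"
    using planar finC finF by (simp add: card_PiE card_cartesian_product)
  moreover have "F ` ?dom \<subseteq> ?cod"
  proof (rule image_subsetI)
    fix phi assume "phi \<in> ?dom"
    then have "?a phi 0 \<in> ?Z" using face[of 0 True] nonempty by (blast intro: PiE_mem)
    then show "F phi \<in> ?cod" using e by (simp add: F_def)
  qed
  ultimately have surj: "F ` ?dom = ?cod"
    using finC by (intro card_subset_eq) (simp_all add: finite_PiE)
  \<comment> \<open>The reduced form \<open>1 mod int e\<close> keeps the difference inside the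
    codomain when \<open>e = 1\<close>.\<close>
  have "(0, 1 mod int e, \<lambda>c\<in>?C. 0) \<in> ?cod" using e by simp
  then obtain phi where phi: "phi \<in> ?dom" "F phi = (0, 1 mod int e, \<lambda>c\<in>?C. 0)"
    unfolding surj[symmetric] by force
  show thesis
  proof (rule that[of "?a phi" "?b phi"])
    fix i assume i: "i < length w"
    show "?a phi i \<in> ?Z" using phi(1) face[OF i] by (blast intro: PiE_mem)
    have "[?d phi i = ?d phi 0] (mod int e)"
    proof (rule potential_difference_constant[OF _ _ i])
      fix j assume j: "j < length w" "level (w ! j) = Over"
      have "(\<lambda>c\<in>?C. (?d phi (?o c) - ?d phi (prev_edge w (?o c))) mod int e) = (\<lambda>c\<in>?C. 0)"
        using phi(2) unfolding F_def by blast
      from fun_cong[OF this, of "crossing (w ! j)"]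
      show "[?d phi j = ?d phi (prev_edge w j)] (mod int e)"
        using over[OF j] by (simp add: mod_eq_0_iff_dvd cong_iff_dvd_diff)
    qed (simp only: rel[of _ phi] cong_refl simp_thms)
    moreover have "[?d phi 0 = 1] (mod int e)"
      using phi(2) unfolding F_def cong_def by blast
    ultimately show "[?d phi i = 1] (mod int e)" by (rule cong_trans)
  qed (simp only: rel[of _ phi] simp_thms)
qed

end

section \<open>Edge weights and the dependence among the colouring relations\<close>

context linear_quandle begin

definition arc_relation :: "gauss_code \<Rightarrow> (nat \<Rightarrow> int) \<Rightarrow> nat \<Rightarrow> int" where
  "arc_relation w X c = coef (crossing_sign w c) * X (under_in w c)
     + (1 - coef (crossing_sign w c)) * X (over_arc w c) - X c"

text \<open>Powers of \<open>m'\<close> depend modulo \<open>q\<close> only on the exponent modulo \<open>totient q\<close>, so a numbering of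
  the faces modulo \<open>totient q\<close> suffices.\<close>

lemma exists_edge_weights:
  assumes knot: "knot_diagram w" and nonempty: "w \<noteq> []"
  obtains W :: "nat \<Rightarrow> int" where
    "\<And>i. i < length w \<Longrightarrow> coprime (W i) (int q)"
    "\<And>c. c \<in> crossings w \<Longrightarrow>
       [W (passage_index w Under c) = W (prev_edge w (passage_index w Over c))] (mod int q)"
    "\<And>c. c \<in> crossings w \<Longrightarrow>
       [W (passage_index w Over c) = coef (crossing_sign w c) * W (passage_index w Under c)] (mod int q)"
    "\<And>c. c \<in> crossings w \<Longrightarrow>
       [W (prev_edge w (passage_index w Under c)) =
          coef (crossing_sign w c) * W (passage_index w Under c)] (mod int q)"
proof -
  have wf: "well_formed w" and planar: "card (faces w) = card (crossings w) + 2"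
    using knot nonempty by (auto simp: knot_diagram_def)
  let ?e = "totient q"
  have e: "?e > 0" using q_pos by simp
  have cop: "coprime m' (int q)"
    using inverse_cong by (metis coprime_iff_invertible_int mult.commute)
  have "[int (nat (m' mod int q)) ^ ?e = 1] (mod int q)"
  proof -
    have m': "int (nat (m' mod int q)) = m' mod int q" using q_pos by simp
    have "coprime (nat (m' mod int q)) q"
      using cop by (metis coprime_int_iff coprime_mod_left_iff m' of_nat_0_less_iff q_pos less_numeral_extra(3))
    from euler_theorem[OF this] show ?thesis
      by (metis cong_int_iff of_nat_1 of_nat_power)
  qed
  then have one: "[m' ^ ?e = 1] (mod int q)"
    using q_pos by (simp add: cong_def power_mod)
  have pow: "[m' ^ nat x = m' ^ nat y] (mod int q)"
    if "0 \<le> x" "0 \<le> y" "[x = y] (mod int ?e)" for x y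
  proof -
    have reduce: "[m' ^ n = m' ^ (n mod ?e)] (mod int q)" for n
    proof -
      have "m' ^ n = (m' ^ ?e) ^ (n div ?e) * m' ^ (n mod ?e)"
        by (metis mult_div_mod_eq power_add power_mult)
      also have "[\<dots> = 1 ^ (n div ?e) * m' ^ (n mod ?e)] (mod int q)"
        by (intro cong_mult cong_pow one cong_refl)
      finally show ?thesis by simp
    qed
    have "nat x mod ?e = nat y mod ?e"
      using that e by (metis cong_def nat_int nat_mod_distrib of_nat_0_le_iff)
    then show ?thesis using reduce[of "nat x"] reduce[of "nat y"] by (metis cong_sym cong_trans)
  qed
  obtain a b :: "nat \<Rightarrow> int" where
    a: "\<And>i. i < length w \<Longrightarrow> a i \<in> {0..<int ?e}"
    and ab: "\<And>i. i < length w \<Longrightarrow> [a i - b i = 1] (mod int ?e)"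
    and rel: "\<And>i. i < length w \<Longrightarrow> crossed_leftwards w i \<Longrightarrow>
      a (prev_edge w i) = a (partner w i) \<and> b i = b (prev_edge w (partner w i)) \<and>
      a (prev_edge w (partner w i)) = b (prev_edge w i) \<and> b (partner w i) = a i"
    using exists_face_numbering[OF wf planar nonempty e] by blast
  \<comment> \<open>An edge is weighted by the number of the face on its left; the representatives
    in \<open>{0..<totient q}\<close> make the exponent a natural number.\<close>
  define W where "W = (\<lambda>i. m' ^ nat (a i))"
  have strands: "W (partner w i) = W (prev_edge w i)"
      "[m' * W i = W (prev_edge w i)] (mod int q)"
      "[m' * W (prev_edge w (partner w i)) = W (prev_edge w i)] (mod int q)"
    if i: "i < length w" "crossed_leftwards w i" for i
  proof -
    let ?k = "partner w i"
    note k = partner_less[OF wf i(1)] and pi = prev_edge_less[OF i(1)]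
    note pk = prev_edge_less[OF k]
    note r = rel[OF i]
    have step: "[m' * W j = W (prev_edge w i)] (mod int q)"
      if j: "j < length w" "[a j + 1 = a (prev_edge w i)] (mod int ?e)" for j
    proof -
      have "0 \<le> a j" "0 \<le> a (prev_edge w i)" using a[OF j(1)] a[OF pi] by simp_all
      then show ?thesis
        using pow[OF _ _ j(2)] by (simp add: W_def nat_add_distrib)
    qed
    show "W ?k = W (prev_edge w i)" using r by (simp add: W_def)
    show "[m' * W i = W (prev_edge w i)] (mod int q)"
    proof (rule step[OF i(1)])
      \<comment> \<open>The face left of edge \<open>i\<close> lies to the right of edge
        \<open>?k\<close>, so its number is one below that of the face left of \<open>?k\<close>,
        which is also left of the edge arriving at \<open>i\<close>.\<close>
      have "[a ?k - b ?k = 1] (mod int ?e)" by (rule ab[OF k])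
      then show "[a i + 1 = a (prev_edge w i)] (mod int ?e)"
        using r by (simp add: cong_iff_dvd_diff dvd_diff_commute algebra_simps)
    qed
    show "[m' * W (prev_edge w ?k) = W (prev_edge w i)] (mod int q)"
    proof (rule step[OF pk])
      have "[a (prev_edge w i) - b (prev_edge w i) = 1] (mod int ?e)" by (rule ab[OF pi])
      then show "[a (prev_edge w ?k) + 1 = a (prev_edge w i)] (mod int ?e)"
        using r by (simp add: cong_iff_dvd_diff dvd_diff_commute algebra_simps)
    qed
  qed
  have flip: "[x = m * y] (mod int q)" if "[m' * x = y] (mod int q)" for x y
  proof -
    have "[(m * m') * x = m * y] (mod int q)"
      using cong_mult[OF cong_refl that, of m] by (simp add: mult.assoc)
    moreover have "[(m * m') * x = 1 * x] (mod int q)"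
      by (intro cong_mult inverse_cong cong_refl)
    ultimately show ?thesis by (metis cong_sym cong_trans mult_1)
  qed
  have all: "[W (passage_index w Under c) = W (prev_edge w (passage_index w Over c))] (mod int q) \<and>
    [W (passage_index w Over c) = coef (crossing_sign w c) * W (passage_index w Under c)] (mod int q) \<and>
    [W (prev_edge w (passage_index w Under c)) =
          coef (crossing_sign w c) * W (passage_index w Under c)] (mod int q)"
    if c: "c \<in> crossings w" for c
  proof -
    let ?o = "passage_index w Over c" and ?u = "passage_index w Under c"
    note o = passage_index[OF wf c, of Over] and u = passage_index[OF wf c, of Under]
    have sign: "csign (w ! ?o) = crossing_sign w c" "csign (w ! ?u) = crossing_sign w c"
      using csign_eq[OF wf] o u by simp_all
    have partners: "partner w ?o = ?u" "partner w ?u = ?o"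
      using o u by (simp_all add: partner_def)
    show ?thesis
    proof (cases "crossing_sign w c")
      case Pos
      then have "crossed_leftwards w ?o" using sign o by (simp add: crossed_leftwards_def)
      note s = strands[OF o(1) this, unfolded partners]
      show ?thesis using s(1) flip[OF s(2)] flip[OF s(3)] Pos by simp
    next
      case Neg
      then have "crossed_leftwards w ?u" using sign u by (simp add: crossed_leftwards_def)
      note s = strands[OF u(1) this, unfolded partners]
      have "[W ?u = W (prev_edge w ?o)] (mod int q)"
        using flip[OF s(2)] flip[OF s(3)] by (metis cong_sym cong_trans)
      then show ?thesis using s(1) cong_sym[OF s(2)] Neg by simp
    qed
  qed
  show thesis
  proof (rule that[of W])
    show "coprime (W i) (int q)" for i using cop by (simp add: W_def)
  qed (use all in blast)+
qed

lemma sum_over_passages: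
  fixes t :: "nat \<Rightarrow> int"
  assumes wf: "well_formed w"
  shows "(\<Sum>i<length w. t i) =
    (\<Sum>c\<in>crossings w. t (passage_index w Over c) + t (passage_index w Under c))"
proof -
  have levels: "UNIV = {Over, Under}" by (auto intro: level.exhaust)
  have "bij_betw (\<lambda>(c, l). passage_index w l c) (crossings w \<times> UNIV) {..<length w}"
  proof (rule bij_betw_byWitness[where f' = "\<lambda>i. (crossing (w ! i), level (w ! i))"])
    show "(\<lambda>i. (crossing (w ! i), level (w ! i))) ` {..<length w} \<subseteq> crossings w \<times> UNIV"
      by (auto simp: crossings_def)
  qed (use passage_index[OF wf] passage_index_nth[OF wf] in auto)
  then have "(\<Sum>i<length w. t i) = (\<Sum>x\<in>crossings w \<times> UNIV. t ((\<lambda>(c, l). passage_index w l c) x))"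
    by (rule sum.reindex_bij_betw[symmetric])
  also have "\<dots> = (\<Sum>c\<in>crossings w. \<Sum>l\<in>UNIV. t (passage_index w l c))"
    by (simp add: sum.cartesian_product case_prod_unfold)
  finally show ?thesis by (simp add: levels)
qed

text \<open>Summing the weighted differences of the colours around the knot gives zero, and the two
  passages through a crossing contribute a unit multiple of its colouring relation.\<close>

lemma arc_relation_redundant:
  assumes knot: "knot_diagram w" and c0: "c0 \<in> crossings w"
    and others: "\<And>c. c \<in> crossings w \<Longrightarrow> c \<noteq> c0 \<Longrightarrow> [arc_relation w X c = 0] (mod int q)"
  shows "[arc_relation w X c0 = 0] (mod int q)"
proof -
  have nonempty: "w \<noteq> []" using c0 by auto
  have wf: "well_formed w" using knot by (simp add: knot_diagram_def)
  obtain W where cop: "\<And>i. i < length w \<Longrightarrow> coprime (W i) (int q)"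
    and W: "\<And>c. c \<in> crossings w \<Longrightarrow>
       [W (passage_index w Under c) = W (prev_edge w (passage_index w Over c))] (mod int q)"
    "\<And>c. c \<in> crossings w \<Longrightarrow>
       [W (passage_index w Over c) = coef (crossing_sign w c) * W (passage_index w Under c)] (mod int q)"
    "\<And>c. c \<in> crossings w \<Longrightarrow>
       [W (prev_edge w (passage_index w Under c)) =
          coef (crossing_sign w c) * W (passage_index w Under c)] (mod int q)"
    using exists_edge_weights[OF knot nonempty] by blast
  \<comment> \<open>\<open>E i\<close> is the colour of the edge leaving passage \<open>i\<close>,
    so the sum of \<open>?t\<close> over all passages telescopes around the knot.\<close>
  define E where "E = (\<lambda>i. X (arc_before w (Suc i)))"
  have E_prev: "E (prev_edge w i) = X (arc_before w i)" if "i < length w" for i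
    using that by (cases i) (simp_all add: E_def prev_edge_def)
  let ?t = "\<lambda>i. W (prev_edge w i) * E (prev_edge w i) - W i * E i"
  let ?V = "\<lambda>c. W (passage_index w Under c)"
  have "(\<Sum>i<length w. W (prev_edge w i) * E (prev_edge w i)) = (\<Sum>i<length w. W i * E i)"
    by (rule sum.reindex_bij_betw[OF bij_betw_prev_edge])
  then have zero: "(\<Sum>i<length w. ?t i) = 0" by (simp add: sum_subtractf)
  have pair: "[?t (passage_index w Over c) + ?t (passage_index w Under c) =
      ?V c * arc_relation w X c] (mod int q)" if c: "c \<in> crossings w" for c
  proof -
    let ?o = "passage_index w Over c" and ?u = "passage_index w Under c"
    let ?k = "coef (crossing_sign w c)"
    note o = passage_index[OF wf c, of Over] and u = passage_index[OF wf c, of Under]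
    have E: "E ?o = X (over_arc w c)" "E (prev_edge w ?o) = X (over_arc w c)"
      "E ?u = X c" "E (prev_edge w ?u) = X (under_in w c)"
      using E_prev[OF o(1)] E_prev[OF u(1)] o u arc_before_Suc[OF o(1)] arc_before_Suc[OF u(1)]
      by (simp_all add: E_def over_arc_def under_in_def)
    \<comment> \<open>At the over-passage only the weight changes, which produces the factor
      \<open>1 - ?k\<close>; the under-passage contributes the incoming and outgoing
      under-arcs.\<close>
    have "[?t ?o + ?t ?u = (?V c * X (over_arc w c) - ?k * ?V c * X (over_arc w c))
        + (?k * ?V c * X (under_in w c) - ?V c * X c)] (mod int q)"
      unfolding E using W[OF c] by (intro cong_add cong_diff cong_mult cong_refl) (auto intro: cong_sym)
    then show ?thesis by (simp add: arc_relation_def algebra_simps)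
  qed
  have "0 = (\<Sum>c\<in>crossings w. ?t (passage_index w Over c) + ?t (passage_index w Under c))"
    using zero sum_over_passages[OF wf, of ?t] by simp
  also have "[\<dots> = (\<Sum>c\<in>crossings w. ?V c * arc_relation w X c)] (mod int q)"
    by (intro cong_sum pair)
  also have "(\<Sum>c\<in>crossings w. ?V c * arc_relation w X c) =
      ?V c0 * arc_relation w X c0 + (\<Sum>c\<in>crossings w - {c0}. ?V c * arc_relation w X c)"
    using c0 by (simp add: sum.remove)
  also have "[\<dots> = ?V c0 * arc_relation w X c0 + (\<Sum>c\<in>crossings w - {c0}. ?V c * 0)] (mod int q)"
    using others by (intro cong_add cong_sum cong_mult cong_refl) simp
  finally have "[?V c0 * arc_relation w X c0 = 0] (mod int q)"
    by (simp add: cong_sym_eq)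
  then show ?thesis
    using cop[OF passage_index_less[OF wf c0, of Under]]
    by (simp add: cong_0_iff coprime_dvd_mult_right_iff coprime_commute)
qed

end

section \<open>Colouring matrices\<close>

definition eval_monom :: "int \<Rightarrow> int \<Rightarrow> int \<Rightarrow> int" where
  "eval_monom m m' k = (if 0 \<le> k then m ^ nat k else m' ^ nat (- k))"

text \<open>Unlike \<open>laurent_eval\<close>, nothing is reduced, so one integer matrix can be
  studied modulo every divisor. The price is that multiplicativity holds only as a congruence, see
  \<open>ev_mult\<close>.\<close>

definition eval_laurent :: "int \<Rightarrow> int \<Rightarrow> laurent \<Rightarrow> int" where
  "eval_laurent m m' p =
     (\<Sum>k\<in>Poly_Mapping.keys p. Poly_Mapping.lookup p k * eval_monom m m' k)"

lemma laurent_eval_eq: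
  "laurent_eval n m p = eval_laurent m (modular_inverse (int n) m) p mod int n"
  by (simp add: laurent_eval_def eval_laurent_def eval_monom_def)

lemma eval_laurent_superset:
  assumes "finite S" "Poly_Mapping.keys p \<subseteq> S"
  shows "eval_laurent m m' p = (\<Sum>k\<in>S. Poly_Mapping.lookup p k * eval_monom m m' k)"
  unfolding eval_laurent_def using assms
  by (intro sum.mono_neutral_left) (auto simp: in_keys_iff)

lemma eval_laurent_add: "eval_laurent m m' (p + r) = eval_laurent m m' p + eval_laurent m m' r"
proof -
  let ?S = "Poly_Mapping.keys p \<union> Poly_Mapping.keys r"
  have "eval_laurent m m' (p + r) = (\<Sum>k\<in>?S. Poly_Mapping.lookup (p + r) k * eval_monom m m' k)"
    by (intro eval_laurent_superset keys_add) simp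
  also have "\<dots> = eval_laurent m m' p + eval_laurent m m' r"
    by (simp add: lookup_add distrib_right sum.distrib eval_laurent_superset[of ?S])
  finally show ?thesis .
qed

lemma eval_laurent_single [simp]: "eval_laurent m m' (Poly_Mapping.single k a) = a * eval_monom m m' k"
  by (simp add: eval_laurent_def)

lemma eval_laurent_0 [simp]: "eval_laurent m m' 0 = 0"
  by (simp add: eval_laurent_def)

lemma eval_laurent_1 [simp]: "eval_laurent m m' 1 = 1"
  using eval_laurent_single[of m m' 0 1] by (simp add: eval_monom_def)

lemma eval_laurent_uminus [simp]: "eval_laurent m m' (- p) = - eval_laurent m m' p"
  using eval_laurent_add[of m m' p "- p"] by simp

lemma eval_laurent_diff: "eval_laurent m m' (p - r) = eval_laurent m m' p - eval_laurent m m' r"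
  using eval_laurent_add[of m m' p "- r"] by simp

lemma eval_laurent_sum: "eval_laurent m m' (sum f S) = (\<Sum>i\<in>S. eval_laurent m m' (f i))"
  by (induction S rule: infinite_finite_induct) (simp_all add: eval_laurent_add)

lemma sum_monomials: "(\<Sum>k\<in>Poly_Mapping.keys p. Poly_Mapping.single k (Poly_Mapping.lookup p k)) = p"
  by (rule poly_mapping_eqI) (simp add: lookup_sum lookup_single when_def in_keys_iff sum.delta)

context linear_quandle begin

abbreviation ev :: "laurent \<Rightarrow> int" where "ev \<equiv> eval_laurent m m'"

lemma coef_eq_eval_monom: "coef s = eval_monom m m' (if s = Pos then 1 else - 1)"
  by (cases s) (simp_all add: eval_monom_def)

lemma coprime_m': "coprime m' (int q)"
  using inverse_cong by (metis coprime_iff_invertible_int mult.commute)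

lemma coprime_m: "coprime m (int q)"
  using inverse_cong by (metis coprime_iff_invertible_int)

lemma coprime_eval_monom: "coprime (eval_monom m m' k) (int q)"
  using coprime_m coprime_m' by (simp add: eval_monom_def)

lemma eval_monom_step: "[eval_monom m m' (k + 1) = eval_monom m m' k * m] (mod int q)"
proof (cases "0 \<le> k")
  case True
  then show ?thesis by (simp add: eval_monom_def nat_add_distrib mult.commute)
next
  case False
  then have "nat (- k) = Suc (nat (- (k + 1)))" by simp
  then have "eval_monom m m' k * m = m' ^ nat (- (k + 1)) * (m * m')"
    using False by (simp add: eval_monom_def mult.commute)
  moreover have "[m' ^ nat (- (k + 1)) * (m * m') = m' ^ nat (- (k + 1)) * 1] (mod int q)"
    by (intro cong_mult cong_refl inverse_cong)
  moreover have "m' ^ nat (- (k + 1)) = eval_monom m m' (k + 1)"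
    using False by (cases "k = -1") (simp_all add: eval_monom_def)
  ultimately show ?thesis by (metis cong_sym mult_1_right)
qed

text \<open>Induction in both directions from 0; the downward step cancels the factor
  \<open>m\<close>, a unit modulo \<open>q\<close>.\<close>

lemma eval_monom_add: "[eval_monom m m' (j + k) = eval_monom m m' j * eval_monom m m' k] (mod int q)"
proof (induction k rule: int_induct[of _ 0])
  case base
  then show ?case by (simp add: eval_monom_def)
next
  case (step1 k)
  have "[eval_monom m m' (j + (k + 1)) = eval_monom m m' (j + k) * m] (mod int q)"
    using eval_monom_step[of "j + k"] by (simp add: add.assoc)
  also have "[eval_monom m m' (j + k) * m = eval_monom m m' j * eval_monom m m' k * m] (mod int q)"
    by (intro cong_mult cong_refl step1)
  also have "eval_monom m m' j * eval_monom m m' k * m = eval_monom m m' j * (eval_monom m m' k * m)"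
    by (simp add: mult.assoc)
  also have "[\<dots> = eval_monom m m' j * eval_monom m m' (k + 1)] (mod int q)"
    by (intro cong_mult cong_refl cong_sym[OF eval_monom_step])
  finally show ?case .
next
  case (step2 k)
  have "[eval_monom m m' (j + (k - 1)) * m = eval_monom m m' (j + k)] (mod int q)"
    using eval_monom_step[of "j + (k - 1)"] by (simp add: cong_sym_eq)
  also have "[eval_monom m m' (j + k) = eval_monom m m' j * eval_monom m m' k] (mod int q)"
    by (rule step2)
  also have "[eval_monom m m' j * eval_monom m m' k = eval_monom m m' j * (eval_monom m m' (k - 1) * m)] (mod int q)"
    using eval_monom_step[of "k - 1"] by (intro cong_mult cong_refl) simp
  finally have "[eval_monom m m' (j + (k - 1)) * m = (eval_monom m m' j * eval_monom m m' (k - 1)) * m] (mod int q)"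
    by (simp add: mult.assoc)
  then show ?case using coprime_m by (simp add: cong_mult_rcancel)
qed

lemma ev_mult: "[ev (p * r) = ev p * ev r] (mod int q)"
proof -
  let ?P = "Poly_Mapping.keys p" and ?R = "Poly_Mapping.keys r"
  let ?p = "Poly_Mapping.lookup p" and ?r = "Poly_Mapping.lookup r"
  have "p * r = (\<Sum>j\<in>?P. \<Sum>k\<in>?R. Poly_Mapping.single (j + k) (?p j * ?r k))"
    by (subst (1 2) sum_monomials[symmetric]) (simp add: sum_product mult_single)
  then have "ev (p * r) = (\<Sum>j\<in>?P. \<Sum>k\<in>?R. (?p j * ?r k) * eval_monom m m' (j + k))"
    by (simp add: eval_laurent_sum)
  also have "[\<dots> = (\<Sum>j\<in>?P. \<Sum>k\<in>?R. (?p j * ?r k) * (eval_monom m m' j * eval_monom m m' k))] (mod int q)"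
    by (intro cong_sum cong_mult cong_refl eval_monom_add)
  also have "(\<Sum>j\<in>?P. \<Sum>k\<in>?R. (?p j * ?r k) * (eval_monom m m' j * eval_monom m m' k)) = ev p * ev r"
    by (simp add: eval_laurent_def sum_product ac_simps)
  finally show ?thesis .
qed

lemma ev_prod: "[ev (prod f S) = (\<Prod>i\<in>S. ev (f i))] (mod int q)"
proof (induction S rule: infinite_finite_induct)
  case (insert x S)
  then show ?case
    using cong_trans[OF ev_mult cong_mult[OF cong_refl insert(3)]] by simp
qed simp_all

text \<open>As \<open>ev\<close> is multiplicative only modulo \<open>q\<close>, it is not a ring
  homomorphism to the integers; the determinants are compared term by term in the Leibniz
  formula.\<close>

lemma ev_det:
  assumes A: "A \<in> carrier_mat k k"
  shows "[ev (det A) = det (map_mat ev A)] (mod int q)"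
proof -
  have sign: "ev (signof p) = signof p" for p :: "nat \<Rightarrow> nat"
    by (simp add: sign_def)
  have summand: "[ev (signof p * prod f S) = signof p * (\<Prod>i\<in>S. ev (f i))] (mod int q)"
    for p :: "nat \<Rightarrow> nat" and f and S :: "nat set"
  proof -
    have "[ev (signof p * prod f S) = ev (signof p) * ev (prod f S)] (mod int q)"
      by (rule ev_mult)
    also have "[ev (signof p) * ev (prod f S) = ev (signof p) * (\<Prod>i\<in>S. ev (f i))] (mod int q)"
      by (intro cong_mult cong_refl ev_prod)
    finally show ?thesis by (simp only: sign)
  qed
  have "ev (det A) = (\<Sum>p | p permutes {0..<k}. ev (signof p * (\<Prod>i = 0..<k. A $$ (i, p i))))"
    by (simp add: det_def'[OF A] eval_laurent_sum)
  also have "[\<dots> = (\<Sum>p | p permutes {0..<k}. signof p * (\<Prod>i = 0..<k. ev (A $$ (i, p i))))] (mod int q)"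
    by (intro cong_sum summand)
  also have "(\<Sum>p | p permutes {0..<k}. signof p * (\<Prod>i = 0..<k. ev (A $$ (i, p i)))) = det (map_mat ev A)"
    using A by (subst det_def'[of _ k]) (auto intro!: sum.cong prod.cong simp: permutes_in_image)
  finally show ?thesis .
qed

section \<open>Kernels under matrix operations and kernels of triangular matrices\<close>

text \<open>Row operations keep the solution set itself, since the scaling factors evaluate to units
  modulo \<open>q\<close>. A column swap permutes the coordinates of the solutions and preserves
  only their number.\<close>

lemma card_mod_kernel_operation:
  assumes "matrix_operation A B"
  shows "card (mod_kernel q (map_mat ev B)) = card (mod_kernel q (map_mat ev A))"
  using assms
proof cases
  case (scale_row i a)
  have dims: "dim_row B = dim_row A" "dim_col B = dim_col A" using scale_row by simp_all
  have unit: "coprime (ev a) (int q)"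
    using scale_row(3) coprime_eval_monom by auto
  have "[mat_apply (map_mat ev B) x r = 0] (mod int q) \<longleftrightarrow>
      [mat_apply (map_mat ev A) x r = 0] (mod int q)" if r: "r < dim_row A" for x r
  proof (cases "r = i")
    case True
    have "mat_apply (map_mat ev B) x r = (\<Sum>j<dim_col A. ev (a * A $$ (r, j)) * x j)"
      unfolding mat_apply_def using r True scale_row by (auto intro!: sum.cong)
    also have "[\<dots> = (\<Sum>j<dim_col A. (ev a * ev (A $$ (r, j))) * x j)] (mod int q)"
      by (intro cong_sum cong_mult cong_refl ev_mult)
    also have "(\<Sum>j<dim_col A. (ev a * ev (A $$ (r, j))) * x j) = ev a * mat_apply (map_mat ev A) x r"
      using r by (simp add: mat_apply_def sum_distrib_left mult.assoc)
    finally have "[mat_apply (map_mat ev B) x r = ev a * mat_apply (map_mat ev A) x r] (mod int q)" .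
    then have "int q dvd mat_apply (map_mat ev B) x r \<longleftrightarrow> int q dvd ev a * mat_apply (map_mat ev A) x r"
      by (rule cong_dvd_iff)
    also have "\<dots> \<longleftrightarrow> int q dvd mat_apply (map_mat ev A) x r"
      using unit by (simp add: coprime_dvd_mult_right_iff coprime_commute)
    finally show ?thesis by (simp add: cong_0_iff)
  next
    case False
    then have "mat_apply (map_mat ev B) x r = mat_apply (map_mat ev A) x r"
      unfolding mat_apply_def using r scale_row by (auto intro!: sum.cong)
    then show ?thesis by simp
  qed
  then show ?thesis by (simp add: mod_kernel_def dims cong: conj_cong)
next
  case (add_row i j)
  have dims: "dim_row B = dim_row A" "dim_col B = dim_col A" using add_row by simp_all
  have i: "mat_apply (map_mat ev B) x i = mat_apply (map_mat ev A) x j + mat_apply (map_mat ev A) x i"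
    and other: "r < dim_row A \<Longrightarrow> r \<noteq> i \<Longrightarrow> mat_apply (map_mat ev B) x r = mat_apply (map_mat ev A) x r"
    for x r
    unfolding mat_apply_def using add_row
    by (auto intro!: sum.cong simp: sum.distrib[symmetric] eval_laurent_add distrib_right)
  have "(\<forall>r<dim_row A. [mat_apply (map_mat ev B) x r = 0] (mod int q)) \<longleftrightarrow>
      (\<forall>r<dim_row A. [mat_apply (map_mat ev A) x r = 0] (mod int q))" for x
  proof -
    have "int q dvd mat_apply (map_mat ev A) x j \<Longrightarrow>
      int q dvd mat_apply (map_mat ev B) x i \<longleftrightarrow> int q dvd mat_apply (map_mat ev A) x i"
      unfolding i by (rule dvd_add_right_iff)
    then show ?thesis
      using other add_row unfolding cong_0_iff by metis
  qed
  then show ?thesis by (simp add: mod_kernel_def dims)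
next
  case (swap_rows i j)
  have dims: "dim_row B = dim_row A" "dim_col B = dim_col A" using swap_rows by simp_all
  have "mat_apply (map_mat ev B) x i = mat_apply (map_mat ev A) x j"
    "mat_apply (map_mat ev B) x j = mat_apply (map_mat ev A) x i"
    "r < dim_row A \<Longrightarrow> r \<noteq> i \<Longrightarrow> r \<noteq> j \<Longrightarrow>
      mat_apply (map_mat ev B) x r = mat_apply (map_mat ev A) x r" for x r
    unfolding mat_apply_def using swap_rows by (auto intro!: sum.cong)
  then have "(\<forall>r<dim_row A. [mat_apply (map_mat ev B) x r = 0] (mod int q)) \<longleftrightarrow>
      (\<forall>r<dim_row A. [mat_apply (map_mat ev A) x r = 0] (mod int q))" for x
    using swap_rows by metis
  then show ?thesis by (simp add: mod_kernel_def dims)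
next
  case (swap_cols k l)
  have dims: "dim_row B = dim_row A" "dim_col B = dim_col A" using swap_cols by simp_all
  let ?t = "Transposition.transpose k l"
  let ?f = "\<lambda>x :: nat \<Rightarrow> int. x \<circ> ?t"
  have perm: "?t permutes {..<dim_col A}"
    using swap_cols by (intro permutes_swap_id) auto
  have apply_B: "mat_apply (map_mat ev B) (?f x) r = mat_apply (map_mat ev A) x r" if "r < dim_row A" for x r
  proof -
    have "mat_apply (map_mat ev B) (?f x) r = (\<Sum>j<dim_col A. ev (A $$ (r, ?t j)) * x (?t j))"
      unfolding mat_apply_def using that swap_cols
      by (auto intro!: sum.cong simp: transpose_def)
    also have "\<dots> = (\<Sum>j<dim_col A. ev (A $$ (r, j)) * x j)"
      by (rule sum.permute[OF perm, symmetric, unfolded comp_def])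
    finally show ?thesis using that by (simp add: mat_apply_def)
  qed
  have V: "?f x \<in> mod_vectors q (dim_col A)" if "x \<in> mod_vectors q (dim_col A)" for x
    using that permutes_in_image[OF perm] by (auto simp: mod_vectors_def PiE_iff extensional_def)
  have invol: "?f (?f x) = x" for x by (simp add: comp_assoc)
  have "bij_betw ?f (mod_kernel q (map_mat ev A)) (mod_kernel q (map_mat ev B))"
  proof (rule bij_betw_byWitness[where f' = ?f])
    show "?f ` mod_kernel q (map_mat ev A) \<subseteq> mod_kernel q (map_mat ev B)"
      using V apply_B by (auto simp: mod_kernel_def dims simp del: comp_apply)
    show "?f ` mod_kernel q (map_mat ev B) \<subseteq> mod_kernel q (map_mat ev A)"
    proof (rule image_subsetI)
      fix x assume x: "x \<in> mod_kernel q (map_mat ev B)"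
      have "mat_apply (map_mat ev A) (?f x) r = mat_apply (map_mat ev B) x r" if "r < dim_row A" for r
        using apply_B[OF that, of "?f x"] unfolding invol by simp
      then show "?f x \<in> mod_kernel q (map_mat ev A)"
        using x V[of x] by (simp add: mod_kernel_def dims del: comp_apply)
    qed
  qed (use invol in simp_all)
  then show ?thesis by (rule bij_betw_same_card[symmetric])
qed

lemma card_mod_kernel_equivalent:
  assumes "equivalent_to A B"
  shows "card (mod_kernel q (map_mat ev A)) = card (mod_kernel q (map_mat ev B))"
  using assms unfolding equivalent_to_def
  by (induction rule: rtranclp_induct) (simp_all add: card_mod_kernel_operation)

text \<open>Zero row sums allow subtracting constants: a kernel vector amounts to its last
  coordinate, which is arbitrary, and the differences of the others to it, which form a kernel
  vector of the minor. Hypothesis \<open>last\<close> provides the remaining row.\<close>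

lemma card_mod_kernel_delete_last:
  assumes M: "M \<in> carrier_mat (Suc k) (Suc k)"
    and rows: "\<And>i. i < k \<Longrightarrow> [(\<Sum>j<Suc k. M $$ (i, j)) = 0] (mod int q)"
    and last: "\<And>x. (\<And>i. i < k \<Longrightarrow> [mat_apply M x i = 0] (mod int q)) \<Longrightarrow>
      [mat_apply M x k = 0] (mod int q)"
  shows "card (mod_kernel q M) = q * card (mod_kernel q (mat k k (\<lambda>(i, j). M $$ (i, j))))"
    (is "_ = q * card (mod_kernel q ?M)")
proof -
  have dims: "dim_row M = Suc k" "dim_col M = Suc k" using M by auto
  let ?f = "\<lambda>(t, y). vec_mod q (Suc k) (\<lambda>j. if j < k then y j + t else t)"
  let ?g = "\<lambda>x. (x k, vec_mod q k (\<lambda>j. x j - x k))"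
  have shift: "[mat_apply M (\<lambda>j. if j < k then y j + t else t) i = mat_apply ?M y i] (mod int q)"
    if "i < k" for y t i
  proof -
    have "mat_apply M (\<lambda>j. if j < k then y j + t else t) i =
        mat_apply ?M y i + t * (\<Sum>j<Suc k. M $$ (i, j))"
      using that by (simp add: mat_apply_def dims sum.distrib sum_distrib_left algebra_simps)
    also have "[\<dots> = mat_apply ?M y i + t * 0] (mod int q)"
      using rows[OF that] by (intro cong_add cong_mult cong_refl)
    finally show ?thesis by simp
  qed
  have f: "?f (t, y) \<in> mod_kernel q M" if "t \<in> Zq" "y \<in> mod_kernel q ?M" for t y
  proof -
    let ?x = "?f (t, y)"
    have ker: "[mat_apply M ?x i = 0] (mod int q)" if "i < k" for i
    proof -
      have "[mat_apply M ?x i = mat_apply M (\<lambda>j. if j < k then y j + t else t) i] (mod int q)"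
        unfolding case_prod_conv by (intro mat_apply_cong vec_mod_cong) (simp add: dims)
      also note shift[OF that]
      also have "[mat_apply ?M y i = 0] (mod int q)"
        using \<open>y \<in> _\<close> that by (simp add: mod_kernel_def)
      finally show ?thesis .
    qed
    then have "\<forall>i<Suc k. [mat_apply M ?x i = 0] (mod int q)"
      using last[of ?x] by (auto simp: less_Suc_eq)
    then show ?thesis using q_pos vec_mod_in by (simp add: mod_kernel_def dims)
  qed
  have V: "\<And>j. j < Suc k \<Longrightarrow> x j \<in> Zq" if "x \<in> mod_kernel q M" for x
    using that by (auto simp: mod_kernel_def mod_vectors_def dims PiE_iff)
  have g: "vec_mod q k (\<lambda>j. x j - x k) \<in> mod_kernel q ?M" if x: "x \<in> mod_kernel q M" for x
  proof -
    have "[mat_apply ?M (vec_mod q k (\<lambda>j. x j - x k)) i = 0] (mod int q)" if "i < k" for i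
    proof -
      have "[mat_apply ?M (vec_mod q k (\<lambda>j. x j - x k)) i = mat_apply ?M (\<lambda>j. x j - x k) i] (mod int q)"
        by (intro mat_apply_cong vec_mod_cong) simp
      also have "[mat_apply ?M (\<lambda>j. x j - x k) i =
          mat_apply M (\<lambda>j. if j < k then (x j - x k) + x k else x k) i] (mod int q)"
        by (rule cong_sym[OF shift[OF that]])
      also have "mat_apply M (\<lambda>j. if j < k then (x j - x k) + x k else x k) i = mat_apply M x i"
        unfolding mat_apply_def dims by (intro sum.cong) (auto simp: less_Suc_eq)
      also have "[mat_apply M x i = 0] (mod int q)"
        using x that by (simp add: mod_kernel_def dims)
      finally show ?thesis .
    qed
    then show ?thesis using q_pos vec_mod_in by (simp add: mod_kernel_def)
  qed
  have "bij_betw ?f (Zq \<times> mod_kernel q ?M) (mod_kernel q M)"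
  proof (rule bij_betw_byWitness[where f' = ?g])
    show "\<forall>a\<in>Zq \<times> mod_kernel q ?M. ?g (?f a) = a"
    proof
      fix a assume "a \<in> Zq \<times> mod_kernel q ?M"
      then obtain t y where a: "a = (t, y)" and t: "t \<in> Zq" and y: "y \<in> mod_kernel q ?M" by blast
      let ?x = "?f (t, y)"
      have xk: "?x k = t" using t by (simp add: vec_mod_def)
      have "vec_mod q k (\<lambda>j. ?x j - ?x k) = y"
      proof (rule mod_vectors_eqI)
        show "vec_mod q k (\<lambda>j. ?x j - ?x k) \<in> mod_vectors q k" by (rule vec_mod_in[OF q_pos])
        show "y \<in> mod_vectors q k" using y by (simp add: mod_kernel_def)
        fix j assume j: "j < k"
        have "[vec_mod q k (\<lambda>j. ?x j - ?x k) j = ?x j - ?x k] (mod int q)" by (rule vec_mod_cong[OF j])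
        also have "[?x j - ?x k = (y j + t) - t] (mod int q)"
          unfolding xk using j vec_mod_cong[of j "Suc k" q "\<lambda>j. if j < k then y j + t else t"]
          by (intro cong_diff cong_refl) simp
        finally show "[vec_mod q k (\<lambda>j. ?x j - ?x k) j = y j] (mod int q)" by simp
      qed
      then show "?g (?f a) = a" using xk a by simp
    qed
    show "\<forall>x\<in>mod_kernel q M. ?f (?g x) = x"
    proof
      fix x assume x: "x \<in> mod_kernel q M"
      show "?f (?g x) = x"
      proof (rule mod_vectors_eqI)
        show "?f (?g x) \<in> mod_vectors q (Suc k)" using vec_mod_in[OF q_pos] by simp
        show "x \<in> mod_vectors q (Suc k)" using x by (simp add: mod_kernel_def dims)
        fix j assume j: "j < Suc k"
        have "[?f (?g x) j = (if j < k then vec_mod q k (\<lambda>j. x j - x k) j + x k else x k)] (mod int q)"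
          unfolding case_prod_conv by (rule vec_mod_cong[OF j])
        also have "[(if j < k then vec_mod q k (\<lambda>j. x j - x k) j + x k else x k) =
            (if j < k then (x j - x k) + x k else x k)] (mod int q)"
        proof (cases "j < k")
          case True
          then show ?thesis
            unfolding if_P[OF True] by (intro cong_add vec_mod_cong cong_refl)
        qed simp
        also have "(if j < k then (x j - x k) + x k else x k) = x j"
          using j by (auto simp: less_Suc_eq)
        finally show "[?f (?g x) j = x j] (mod int q)" .
      qed
    qed
    show "?f ` (Zq \<times> mod_kernel q ?M) \<subseteq> mod_kernel q M"
      using f by auto
    show "?g ` mod_kernel q M \<subseteq> Zq \<times> mod_kernel q ?M"
      using g V by blast
  qed
  then have "card (Zq \<times> mod_kernel q ?M) = card (mod_kernel q M)" by (rule bij_betw_same_card)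
  then show ?thesis by (simp add: card_cartesian_product)
qed

text \<open>The top row determines the first coordinate from the others, and no other row involves
  it.\<close>

lemma card_mod_kernel_delete_first:
  assumes M: "M \<in> carrier_mat (Suc k) (Suc k)" and one: "M $$ (0, 0) = 1"
    and zero: "\<And>i. i < k \<Longrightarrow> M $$ (Suc i, 0) = 0"
  shows "card (mod_kernel q M) = card (mod_kernel q (mat k k (\<lambda>(i, j). M $$ (Suc i, Suc j))))"
    (is "_ = card (mod_kernel q ?M)")
proof (rule bij_betw_same_card)
  have dims: "dim_row M = Suc k" "dim_col M = Suc k" using M by auto
  let ?s = "\<lambda>y. \<Sum>j<k. M $$ (0, Suc j) * y j"
  let ?f = "\<lambda>x. \<lambda>j\<in>{..<k}. x (Suc j) :: int"
  let ?g = "\<lambda>y. \<lambda>j\<in>{..<Suc k}. case j of 0 \<Rightarrow> (- ?s y) mod int q | Suc i \<Rightarrow> y i"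
  have top: "mat_apply M x 0 = x 0 + ?s (?f x)" for x
    unfolding mat_apply_def dims sum.lessThan_Suc_shift by (simp add: one)
  have below: "mat_apply M x (Suc i) = mat_apply ?M (?f x) i" if "i < k" for x i
    using that unfolding mat_apply_def dims sum.lessThan_Suc_shift by (simp add: zero)
  have rows: "(\<forall>i<Suc k. [mat_apply M x i = 0] (mod int q)) \<longleftrightarrow>
      [x 0 + ?s (?f x) = 0] (mod int q) \<and> (\<forall>i<k. [mat_apply ?M (?f x) i = 0] (mod int q))" for x
    using top below by (auto simp: less_Suc_eq_0_disj)
  have fg: "?f (?g y) = y" if "y \<in> mod_kernel q ?M" for y
    using that by (auto simp: mod_kernel_def mod_vectors_def PiE_iff extensional_def fun_eq_iff)
  show "bij_betw ?f (mod_kernel q M) (mod_kernel q ?M)"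
  proof (rule bij_betw_byWitness[where f' = ?g])
    show "\<forall>y\<in>mod_kernel q ?M. ?f (?g y) = y" using fg by blast
    show "\<forall>x\<in>mod_kernel q M. ?g (?f x) = x"
    proof
      fix x assume x: "x \<in> mod_kernel q M"
      then have "[x 0 + ?s (?f x) = 0] (mod int q)"
        using rows[of x] by (simp add: mod_kernel_def dims)
      then have "[x 0 = - ?s (?f x)] (mod int q)"
        by (simp add: cong_iff_dvd_diff)
      moreover have xV: "x \<in> mod_vectors q (Suc k)" using x by (simp add: mod_kernel_def dims)
      then have "x 0 \<in> Zq" by (auto simp: mod_vectors_def PiE_iff)
      ultimately have x0: "x 0 = (- ?s (?f x)) mod int q" by (simp add: cong_def)
      show "?g (?f x) = x"
      proof
        fix j
        show "?g (?f x) j = x j"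
          using x0 xV by (cases j) (auto simp: mod_vectors_def PiE_iff extensional_def)
      qed
    qed
    show "?f ` mod_kernel q M \<subseteq> mod_kernel q ?M"
    proof (rule image_subsetI)
      fix x assume x: "x \<in> mod_kernel q M"
      then have "?f x \<in> mod_vectors q k"
        by (auto simp: mod_kernel_def dims mod_vectors_def PiE_iff)
      then show "?f x \<in> mod_kernel q ?M"
        using x rows[of x] by (simp add: mod_kernel_def dims)
    qed
    show "?g ` mod_kernel q ?M \<subseteq> mod_kernel q M"
    proof (rule image_subsetI)
      fix y assume y: "y \<in> mod_kernel q ?M"
      have "?g y \<in> mod_vectors q (Suc k)"
        using y q_pos by (auto simp: mod_kernel_def mod_vectors_def PiE_iff split: nat.split)
      moreover have "[?g y 0 + ?s (?f (?g y)) = 0] (mod int q)"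
        unfolding fg[OF y] by (simp add: cong_def mod_simps)
      ultimately show "?g y \<in> mod_kernel q M"
        using y rows[of "?g y"] unfolding fg[OF y] by (simp add: mod_kernel_def dims)
    qed
  qed
qed

text \<open>Divide \<open>a\<close> and \<open>q\<close> by their gcd \<open>g\<close>, leaving
  coprime \<open>b\<close> and \<open>h\<close>: the annihilated residues are the \<open>g\<close>
  multiples of \<open>h\<close> below \<open>q\<close>.\<close>

lemma card_annihilator: "int (card {d \<in> Zq. [a * d = 0] (mod int q)}) = gcd a (int q)"
proof -
  define g where "g = gcd a (int q)"
  have g: "g > 0" using q_pos by (simp add: g_def)
  obtain b h where bh: "a = b * g" "int q = h * g" "coprime b h"
    using gcd_coprime_exists[of a "int q"] g unfolding g_def by auto
  have "h * g > 0" using bh(2) q_pos by simp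
  then have h: "h > 0" using g by (simp add: zero_less_mult_iff)
  have iff: "[a * d = 0] (mod int q) \<longleftrightarrow> h dvd d" for d
  proof -
    have "[a * d = 0] (mod int q) \<longleftrightarrow> g * h dvd g * (b * d)"
      by (simp add: cong_0_iff bh ac_simps)
    also have "\<dots> \<longleftrightarrow> h dvd d"
      using g bh(3) by (simp add: coprime_dvd_mult_right_iff coprime_commute)
    finally show ?thesis .
  qed
  have "{d \<in> Zq. [a * d = 0] (mod int q)} = (\<lambda>j. h * j) ` {0..<g}"
  proof (intro equalityI subsetI)
    fix d assume d: "d \<in> {d \<in> Zq. [a * d = 0] (mod int q)}"
    then obtain j where j: "d = h * j" using iff by blast
    then have "0 \<le> h * j" "h * j < h * g" using d bh(2) by auto
    then have "j \<in> {0..<g}" using h by (simp add: zero_le_mult_iff)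
    then show "d \<in> (\<lambda>j. h * j) ` {0..<g}" using j by blast
  next
    fix d assume "d \<in> (\<lambda>j. h * j) ` {0..<g}"
    then obtain j where j: "d = h * j" "0 \<le> j" "j < g" by (force simp: image_iff)
    then have "0 \<le> d" "d < h * g" using h by simp_all
    then show "d \<in> {d \<in> Zq. [a * d = 0] (mod int q)}" using iff j(1) bh(2) by simp
  qed
  moreover have "inj_on (\<lambda>j. h * j) {0..<g}" using h by (simp add: inj_on_def)
  ultimately show ?thesis using g by (simp add: card_image g_def)
qed

lemma card_mod_kernel_1x1:
  assumes M: "M \<in> carrier_mat 1 1"
  shows "int (card (mod_kernel q M)) = gcd (M $$ (0, 0)) (int q)"
proof -
  have dims: "dim_row M = 1" "dim_col M = 1" using M by auto
  let ?S = "{d \<in> Zq. [M $$ (0, 0) * d = 0] (mod int q)}"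
  have "bij_betw (\<lambda>x. x 0) (mod_kernel q M) ?S"
    by (rule bij_betw_byWitness[where f' = "\<lambda>d. \<lambda>j\<in>{..<1}. d"])
      (auto simp: mod_kernel_def mod_vectors_def mat_apply_def dims PiE_iff extensional_def)
  from bij_betw_same_card[OF this] show ?thesis by (simp only: card_annihilator)
qed

text \<open>Stripping the leading ones leaves the block with rows \<open>(a, -a)\<close> and
  \<open>(0, 0)\<close>. Its rows sum to zero and the last one is void, so a free coordinate splits
  off and the 1 by 1 matrix \<open>a\<close> remains.\<close>

lemma card_mod_kernel_triangular:
  fixes M :: "int mat"
  assumes "2 \<le> N" "M \<in> carrier_mat N N" "upper_triangular M" "\<forall>i<N - 2. M $$ (i, i) = 1"
    "M $$ (N - 2, N - 2) = a" "M $$ (N - 2, N - 1) = - a" "M $$ (N - 1, N - 1) = 0"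
  shows "int (card (mod_kernel q M)) = int q * gcd a (int q)"
  using assms
proof (induction N arbitrary: M rule: dec_induct)
  case base
  then have M: "M \<in> carrier_mat (Suc 1) (Suc 1)" by (simp add: numeral_2_eq_2)
  have "M $$ (1, 0) = 0" using base by auto
  then have last: "mat_apply M x 1 = 0" for x
    using base by (simp add: mat_apply_def numeral_2_eq_2)
  have "(\<Sum>j<Suc 1. M $$ (0, j)) = 0" using base by simp
  then have "card (mod_kernel q M) = q * card (mod_kernel q (mat 1 1 (\<lambda>(i, j). M $$ (i, j))))"
    using last by (intro card_mod_kernel_delete_last[OF M]) (auto simp: less_Suc_eq)
  moreover have "int (card (mod_kernel q (mat 1 1 (\<lambda>(i, j). M $$ (i, j))))) = gcd a (int q)"
    using base by (subst card_mod_kernel_1x1) auto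
  ultimately show ?case by simp
next
  case (step N)
  let ?M = "mat N N (\<lambda>(i, j). M $$ (Suc i, Suc j))"
  have N: "Suc N - 2 = Suc (N - 2)" "Suc N - 1 = Suc (N - 1)" "N - 2 < N" "N - 1 < N"
    using step(1) by auto
  have zero: "M $$ (i, j) = 0" if "j < i" "i < Suc N" for i j
    using step(5) step(4) that by auto
  have "card (mod_kernel q M) = card (mod_kernel q ?M)"
    using step N zero by (intro card_mod_kernel_delete_first) auto
  also have "int (card (mod_kernel q ?M)) = int q * gcd a (int q)"
  proof (rule step(3))
    show "upper_triangular ?M" using zero by auto
    show "\<forall>i<N - 2. ?M $$ (i, i) = 1" using step(6) N by auto
    show "?M $$ (N - 2, N - 2) = a" "?M $$ (N - 2, N - 1) = - a" "?M $$ (N - 1, N - 1) = 0"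
      using step(7-9) N by simp_all
  qed simp
  finally show ?case .
qed

end

section \<open>Arc colourings as the kernel of the colouring matrix\<close>

context linear_quandle begin

lemma under_in_crossings: "well_formed w \<Longrightarrow> c \<in> crossings w \<Longrightarrow> under_in w c \<in> crossings w"
  and over_arc_crossings: "well_formed w \<Longrightarrow> c \<in> crossings w \<Longrightarrow> over_arc w c \<in> crossings w"
  unfolding under_in_def over_arc_def by (rule arc_before_in_crossings, simp, force)+

lemma arc_colourings_iff:
  assumes "X \<in> crossings w \<rightarrow>\<^sub>E Zq"
  shows "X \<in> arc_colourings w \<longleftrightarrow> (\<forall>c\<in>crossings w. [arc_relation w X c = 0] (mod int q))"
proof -
  have "X c = act (crossing_sign w c) (X (under_in w c)) (X (over_arc w c)) \<longleftrightarrow>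
      [arc_relation w X c = 0] (mod int q)" if "c \<in> crossings w" for c
  proof -
    have "X c \<in> Zq" using assms that by (rule PiE_mem)
    then have "X c = act (crossing_sign w c) (X (under_in w c)) (X (over_arc w c)) \<longleftrightarrow>
        [coef (crossing_sign w c) * X (under_in w c) +
          (1 - coef (crossing_sign w c)) * X (over_arc w c) = X c] (mod int q)"
      by (auto simp: act_def cong_def)
    then show ?thesis by (simp add: arc_relation_def cong_iff_dvd_diff)
  qed
  then show ?thesis using assms by (simp add: arc_colourings_def)
qed

context
  fixes w :: gauss_code and rs cs :: "nat list"
  assumes wf: "well_formed w"
    and rs: "distinct rs" "set rs = crossings w" and cs: "distinct cs" "set cs = crossings w"
begin

abbreviation coeff_matrix :: "int mat" where
  "coeff_matrix \<equiv> map_mat ev (colouring_matrix w rs cs)"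

lemma length_rs: "length rs = card (crossings w)"
  using rs distinct_card by metis

lemma length_cs: "length cs = card (crossings w)"
  using cs distinct_card by metis

lemma coeff_matrix_carrier:
  "coeff_matrix \<in> carrier_mat (card (crossings w)) (card (crossings w))"
  by (simp add: colouring_matrix_def length_rs length_cs)

lemma bij_cs: "bij_betw ((!) cs) {..<card (crossings w)} (crossings w)"
  using bij_betw_nth[OF cs(1)] cs(2) length_cs by metis

text \<open>Every entry is a sum of three indicator terms, so coincidences among the arcs at a
  crossing call for no case distinction.\<close>

lemma mat_apply_coeff_matrix:
  assumes r: "r < card (crossings w)" and x: "\<And>j. j < card (crossings w) \<Longrightarrow> x j = X (cs ! j)"
  shows "mat_apply coeff_matrix x r = arc_relation w X (rs ! r)"
proof -
  let ?c = "rs ! r"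
  let ?t = "coef (crossing_sign w ?c)"
  have c: "?c \<in> crossings w" using r rs length_rs nth_mem by metis
  let ?e = "\<lambda>a. (if a = under_in w ?c then ?t else 0) + (if a = over_arc w ?c then 1 - ?t else 0)
    - (if a = ?c then 1 else 0)"
  have entry: "coeff_matrix $$ (r, j) = ?e (cs ! j)" if "j < card (crossings w)" for j
    using r that by (simp add: colouring_matrix_def length_rs length_cs Let_def eval_laurent_add
        eval_laurent_diff coef_eq_eval_monom crossing_sign_def)
  have "mat_apply coeff_matrix x r = (\<Sum>j<card (crossings w). ?e (cs ! j) * X (cs ! j))"
    unfolding mat_apply_def using entry x coeff_matrix_carrier by (intro sum.cong) auto
  also have "\<dots> = (\<Sum>a\<in>crossings w. ?e a * X a)"
    by (rule sum.reindex_bij_betw[OF bij_cs])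
  also have "\<dots> = (\<Sum>a\<in>crossings w. (if a = under_in w ?c then ?t * X a else 0)
      + (if a = over_arc w ?c then (1 - ?t) * X a else 0) - (if a = ?c then X a else 0))"
    by (intro sum.cong) (auto simp: algebra_simps)
  also have "\<dots> = arc_relation w X ?c"
    using c under_in_crossings[OF wf c] over_arc_crossings[OF wf c]
    by (simp add: sum.distrib sum_subtractf arc_relation_def)
  finally show ?thesis .
qed

lemma card_mod_kernel_coeff_matrix:
  "card (mod_kernel q coeff_matrix) = card (arc_colourings w)"
proof (rule bij_betw_same_card)
  let ?N = "card (crossings w)" and ?C = "crossings w"
  let ?i = "inv_into {..<?N} ((!) cs)"
  let ?f = "\<lambda>x. \<lambda>a\<in>?C. x (?i a) :: int"
  let ?g = "\<lambda>X. \<lambda>j\<in>{..<?N}. X (cs ! j) :: int"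
  have dims: "dim_row (colouring_matrix w rs cs) = ?N" "dim_col (colouring_matrix w rs cs) = ?N"
    by (simp_all add: colouring_matrix_def length_rs length_cs)
  have cs_in: "cs ! j \<in> ?C" "?i (cs ! j) = j" if "j < ?N" for j
    using that bij_cs by (auto simp: bij_betw_def)
  have i_less: "?i a < ?N" "cs ! ?i a = a" if "a \<in> ?C" for a
    using that bij_betw_inv_into_right[OF bij_cs] bij_betw_inv_into[OF bij_cs]
    by (auto simp: bij_betw_def)
  have rows: "(\<forall>r<?N. [arc_relation w X (rs ! r) = 0] (mod int q)) \<longleftrightarrow>
      (\<forall>c\<in>?C. [arc_relation w X c = 0] (mod int q))" for X
    using rs(2) length_rs by (metis in_set_conv_nth)
  show "bij_betw ?f (mod_kernel q coeff_matrix) (arc_colourings w)"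
  proof (rule bij_betw_byWitness[where f' = ?g])
    show "\<forall>x\<in>mod_kernel q coeff_matrix. ?g (?f x) = x"
      using cs_in by (auto simp: mod_kernel_def mod_vectors_def dims PiE_iff extensional_def fun_eq_iff)
    show "\<forall>X\<in>arc_colourings w. ?f (?g X) = X"
      using i_less by (auto simp: arc_colourings_def PiE_iff extensional_def fun_eq_iff)
    show "?f ` mod_kernel q coeff_matrix \<subseteq> arc_colourings w"
    proof (rule image_subsetI)
      fix x assume x: "x \<in> mod_kernel q coeff_matrix"
      then have X: "?f x \<in> ?C \<rightarrow>\<^sub>E Zq"
        using i_less by (auto simp: mod_kernel_def mod_vectors_def dims PiE_iff)
      have "[arc_relation w (?f x) (rs ! r) = 0] (mod int q)" if r: "r < ?N" for r
      proof -
        have "mat_apply coeff_matrix x r = arc_relation w (?f x) (rs ! r)"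
          by (rule mat_apply_coeff_matrix[OF r]) (simp add: cs_in)
        moreover have "[mat_apply coeff_matrix x r = 0] (mod int q)"
          using x r by (simp add: mod_kernel_def dims)
        ultimately show ?thesis by (simp only:)
      qed
      then show "?f x \<in> arc_colourings w"
        unfolding arc_colourings_iff[OF X] rows[symmetric] by blast
    qed
    show "?g ` arc_colourings w \<subseteq> mod_kernel q coeff_matrix"
    proof (rule image_subsetI)
      fix X assume X: "X \<in> arc_colourings w"
      then have XC: "X \<in> ?C \<rightarrow>\<^sub>E Zq" by (simp add: arc_colourings_def)
      then have "?g X \<in> mod_vectors q ?N"
        using cs_in by (auto simp: mod_vectors_def PiE_iff)
      moreover have "[mat_apply coeff_matrix (?g X) r = 0] (mod int q)" if r: "r < ?N" for r
      proof -
        have "mat_apply coeff_matrix (?g X) r = arc_relation w X (rs ! r)"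
          by (rule mat_apply_coeff_matrix[OF r]) simp
        moreover have "[arc_relation w X (rs ! r) = 0] (mod int q)"
          using X r unfolding arc_colourings_iff[OF XC] rows[symmetric] by blast
        ultimately show ?thesis by (simp only:)
      qed
      ultimately show "?g X \<in> mod_kernel q coeff_matrix" by (simp add: mod_kernel_def dims)
    qed
  qed
qed

text \<open>The constant colouring satisfies every relation, which gives the zero row sums. The last
  row is redundant by \<open>arc_relation_redundant\<close>, whichever crossing \<open>rs\<close>
  lists last.\<close>

lemma card_arc_colourings_minor:
  assumes knot: "knot_diagram w" and nonempty: "w \<noteq> []"
  defines "B \<equiv> colouring_matrix w rs cs"
  shows "card (arc_colourings w) =
    q * card (mod_kernel q (map_mat ev (mat_delete B (dim_row B - 1) (dim_col B - 1))))"
proof -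
  have "card (crossings w) > 0"
    using crossings_nonempty[OF nonempty] by (simp add: card_gt_0_iff)
  then obtain k where k: "card (crossings w) = Suc k" by (cases "card (crossings w)") auto
  have B: "dim_row B = Suc k" "dim_col B = Suc k"
    by (simp_all add: B_def colouring_matrix_def length_rs length_cs k)
  have minor: "map_mat ev (mat_delete B (dim_row B - 1) (dim_col B - 1)) =
      mat k k (\<lambda>(i, j). coeff_matrix $$ (i, j))"
    unfolding B_def[symmetric] by (rule eq_matI) (auto simp: mat_delete_def B)
  have "card (mod_kernel q coeff_matrix) = q * card (mod_kernel q (mat k k (\<lambda>(i, j). coeff_matrix $$ (i, j))))"
  proof (rule card_mod_kernel_delete_last)
    show "coeff_matrix \<in> carrier_mat (Suc k) (Suc k)" using coeff_matrix_carrier k by simp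
    show "[(\<Sum>j<Suc k. coeff_matrix $$ (i, j)) = 0] (mod int q)" if "i < k" for i
    proof -
      have "(\<Sum>j<Suc k. coeff_matrix $$ (i, j)) = mat_apply coeff_matrix (\<lambda>_. 1) i"
        using B by (simp add: mat_apply_def B_def)
      also have "\<dots> = arc_relation w (\<lambda>_. 1) (rs ! i)"
        using that k by (intro mat_apply_coeff_matrix) simp_all
      finally show ?thesis by (simp add: arc_relation_def)
    qed
    show "[mat_apply coeff_matrix x k = 0] (mod int q)"
      if x: "\<And>i. i < k \<Longrightarrow> [mat_apply coeff_matrix x i = 0] (mod int q)" for x
    proof -
      define X where "X = (\<lambda>a. x (inv_into {..<Suc k} ((!) cs) a))"
      have X: "x j = X (cs ! j)" if "j < Suc k" for j
        using that bij_cs k by (simp add: X_def bij_betw_def inv_into_f_f)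
      have row: "mat_apply coeff_matrix x i = arc_relation w X (rs ! i)" if "i < Suc k" for i
        using that X k by (intro mat_apply_coeff_matrix) simp_all
      have "[arc_relation w X (rs ! k) = 0] (mod int q)"
      proof (rule arc_relation_redundant[OF knot])
        show "rs ! k \<in> crossings w" using rs length_rs k nth_mem by (metis lessI)
        fix c assume "c \<in> crossings w" "c \<noteq> rs ! k"
        then obtain i where "i < Suc k" "c = rs ! i" "i \<noteq> k"
          using rs length_rs k by (metis in_set_conv_nth)
        then show "[arc_relation w X c = 0] (mod int q)"
          using x[of i] row[of i] by simp
      qed
      then show ?thesis using row by simp
    qed
  qed
  then show ?thesis unfolding minor card_mod_kernel_coeff_matrix .
qed

end

lemma colourings_eq_arc_colourings:
  assumes "m' = modular_inverse (int q) m"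
  shows "colourings q m w = arc_colourings w"
proof -
  have "act Pos x y = quandle_op q m x y" "act Neg x y = quandle_inv_op q m x y" for x y
    unfolding act_def quandle_op_def quandle_inv_op_def assms[symmetric] by simp_all
  then show ?thesis
    unfolding colourings_def arc_colourings_def crossing_sign_def by (auto cong: if_cong)
qed

lemma card_strand_colourings_equivclp:
  assumes "equivclp diagram_move D D'"
  shows "card (strand_colourings D) = card (strand_colourings D')"
  using assms
proof (induction rule: equivclp_induct)
  case (step y z)
  then have "card (strand_colourings y) = card (strand_colourings z)"
    using card_strand_colourings_move unfolding diagram_move_def knot_diagram_def by metis
  with step show ?case by simp
qed simp

end

section \<open>Comparing the diagrams of one knot\<close>

lemma knots_diagrams:
  assumes "K \<in> knots" "D \<in> K" "D' \<in> K"
  shows "knot_diagram D" "equivclp diagram_move D D'"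
proof -
  from assms(1) obtain D0 where D0: "knot_diagram D0"
    "K = {(D, D'). knot_diagram D \<and> equivclp diagram_move D D'} `` {D0}"
    by (auto simp: knots_def elim: quotientE)
  then have D: "equivclp diagram_move D0 D" "equivclp diagram_move D0 D'"
    using assms by auto
  from D(1) show "knot_diagram D"
    by (induction rule: equivclp_induct) (use D0 in \<open>auto simp: diagram_move_def\<close>)
  show "equivclp diagram_move D D'"
    using D by (meson equivclp_sym equivclp_trans)
qed

text \<open>The diagram \<open>D\<close> is arbitrary because the count is applied twice: to the
  diagram whose colourings are asked for, and to the one whose minor represents the Alexander
  polynomial.\<close>

lemma card_colourings_at_divisor:
  fixes A B :: "laurent mat"
  assumes K: "K \<in> knots" and B: "B \<in> colouring_matrices K" and A: "equivalent_to A B" "type_I N A"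
    and D: "D \<in> K" "D \<noteq> []" and d: "d > 0" and inverse: "[m * m' = 1] (mod int d)"
  shows "int (card (linear_quandle.arc_colourings d m m' D)) =
    int d * gcd (eval_laurent m m' (A $$ (N - 2, N - 2))) (int d)"
proof -
  interpret linear_quandle d m m' by unfold_locales (use d inverse in auto)
  obtain E rs cs where E: "E \<in> K" "E \<noteq> []" "B = colouring_matrix E rs cs"
    "distinct rs" "set rs = crossings E" "distinct cs" "set cs = crossings E"
    using B by (auto simp: colouring_matrices_def)
  have wf: "well_formed D" "well_formed E"
    using knots_diagrams(1)[OF K] D(1) E(1) by (auto simp: knot_diagram_def)
  have "card (arc_colourings D) = card (strand_colourings D)"
    by (rule card_arc_colourings[OF wf(1) D(2)])
  also have "\<dots> = card (strand_colourings E)"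
    by (rule card_strand_colourings_equivclp[OF knots_diagrams(2)[OF K D(1) E(1)]])
  also have "\<dots> = card (arc_colourings E)"
    by (rule card_arc_colourings[OF wf(2) E(2), symmetric])
  also have "\<dots> = card (mod_kernel d (map_mat ev B))"
    unfolding E(3) by (rule card_mod_kernel_coeff_matrix[OF wf(2) E(4-7), symmetric])
  also have "\<dots> = card (mod_kernel d (map_mat ev A))"
    by (rule card_mod_kernel_equivalent[OF A(1), symmetric])
  also have "int \<dots> = int d * gcd (ev (A $$ (N - 2, N - 2))) (int d)"
  proof -
    have T: "2 \<le> N" "A \<in> carrier_mat N N" "upper_triangular A" "\<forall>i<N - 2. A $$ (i, i) = 1"
      "A $$ (N - 2, N - 1) = - A $$ (N - 2, N - 2)" "A $$ (N - 1, N - 1) = 0"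
      using A(2) unfolding type_I_def by blast+
    have dims: "dim_row A = N" "dim_col A = N" using T(2) by auto
    have upper: "upper_triangular (map_mat ev A)"
      using T(3) unfolding upper_triangular_def by (simp add: dims)
    have diagonal: "\<forall>i<N - 2. map_mat ev A $$ (i, i) = 1"
      using T(4) by (simp add: dims)
    have corner: "map_mat ev A $$ (N - 2, N - 2) = ev (A $$ (N - 2, N - 2))"
      "map_mat ev A $$ (N - 2, N - 1) = - ev (A $$ (N - 2, N - 2))"
      "map_mat ev A $$ (N - 1, N - 1) = 0"
      using T(1,5,6) by (simp_all add: dims)
    show ?thesis
      by (rule card_mod_kernel_triangular[OF T(1) _ upper diagonal corner]) (simp add: T(2))
  qed
  finally show ?thesis .
qed

theorem proposition10:
  fixes K :: "gauss_code set" and D :: gauss_code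
    and N n :: nat and m :: int and A B :: "laurent mat" and Alex :: laurent
  assumes "K \<in> knots"
    and "B \<in> colouring_matrices K"
    and "equivalent_to A B"
    and "type_I N A"
    and "n > 0"
    and "gcd m (int n) = 1"
    and "alexander_polynomial K Alex"
    and "D \<in> K" and "D \<noteq> []"
  shows "int (card (colourings n m D)) = int n * gcd (laurent_eval n m Alex) (int n)"
proof -
  define m' where "m' = modular_inverse (int n) m"
  have inverse: "[m * m' = 1] (mod int n)"
    using assms(6) cong_modular_inverse1[of m "int n"] by (simp add: m'_def coprime_iff_gcd_eq_1)
  interpret linear_quandle n m m' by unfold_locales (use assms(5) inverse in auto)
  define a where "a = ev (A $$ (N - 2, N - 2))"
  note count = card_colourings_at_divisor[where m = m and m' = m', OF assms(1-4), folded a_def]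
  obtain B' k e where B': "B' \<in> colouring_matrices K" and e: "e \<in> {1, - 1}"
    and Alex: "Alex = laurent_monom e k * det (mat_delete B' (dim_row B' - 1) (dim_col B' - 1))"
    using assms(7) unfolding alexander_polynomial_def by blast
  from B' obtain E rs cs where E: "E \<in> K" "E \<noteq> []" "distinct rs" "set rs = crossings E"
    "distinct cs" "set cs = crossings E" and B'_eq: "B' = colouring_matrix E rs cs"
    unfolding colouring_matrices_def by blast
  define P where "P = mat_delete B' (dim_row B' - 1) (dim_col B' - 1)"
  have knot: "knot_diagram E" by (rule knots_diagrams(1)[OF assms(1) E(1) E(1)])
  then have wf: "well_formed E" by (simp add: knot_diagram_def)
  have lengths: "length rs = length cs"
    using distinct_card[OF E(3)] distinct_card[OF E(5)] E(4,6) by simp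
  have "B' \<in> carrier_mat (length cs) (length cs)"
    unfolding B'_eq colouring_matrix_def lengths by (rule mat_carrier)
  then have P: "P \<in> carrier_mat (length cs - 1) (length cs - 1)"
    unfolding P_def by (rule mat_delete_carrier)
  have "gcd (det (map_mat ev P)) (int n) = gcd a (int n)"
  proof (rule gcd_det_eq_if_card_kernels)
    show "map_mat ev P \<in> carrier_mat (length cs - 1) (length cs - 1)" using P by simp
    show "n > 0" by (rule assms(5))
    fix d assume d: "d dvd n"
    then have d0: "d > 0" using assms(5) by (auto intro: dvd_pos_nat)
    have inv_d: "[m * m' = 1] (mod int d)"
      using inverse d by (meson cong_dvd_modulus int_dvd_int_iff)
    interpret d: linear_quandle d m m' by unfold_locales (use d0 inv_d in auto)
    \<comment> \<open>The colourings of \<open>E\<close> modulo \<open>d\<close> are counted in two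
      ways, by the minor of its own matrix and by the type I matrix of a possibly different diagram;
      the common factor \<open>d\<close> cancels.\<close>
    have "int d * int (card (mod_kernel d (map_mat ev P))) = int (card (d.arc_colourings E))"
      unfolding P_def B'_eq using d.card_arc_colourings_minor[OF wf E(3-6) knot E(2)] by simp
    also have "\<dots> = int d * gcd a (int d)" by (rule count[OF E(1,2) d0 inv_d])
    finally show "int (card (mod_kernel d (map_mat ev P))) = gcd a (int d)"
      using d0 by simp
  qed
  moreover have "gcd (laurent_eval n m Alex) (int n) = gcd (det (map_mat ev P)) (int n)"
  proof -
    have "[laurent_eval n m Alex = ev Alex] (mod int n)"
      by (simp add: laurent_eval_eq m'_def cong_def)
    also have "[ev Alex = ev (laurent_monom e k) * ev (det P)] (mod int n)"
      unfolding Alex P_def by (rule ev_mult)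
    also have "[ev (laurent_monom e k) * ev (det P) = (e * eval_monom m m' k) * det (map_mat ev P)] (mod int n)"
      by (intro cong_mult ev_det[OF P]) simp
    finally have "gcd (laurent_eval n m Alex) (int n) =
        gcd ((e * eval_monom m m' k) * det (map_mat ev P)) (int n)"
      by (rule cong_gcd_eq)
    \<comment> \<open>The indeterminacy of the Alexander polynomial evaluates to a unit modulo
      \<open>n\<close>, invisible to the gcd.\<close>
    moreover have "coprime (e * eval_monom m m' k) (int n)"
      using e coprime_eval_monom by auto
    ultimately show ?thesis
      using gcd_mult_left_left_cancel[of "int n" "e * eval_monom m m' k"] by (simp only: coprime_commute)
  qed
  moreover have "int (card (colourings n m D)) = int n * gcd a (int n)"
    using count[OF assms(8,9,5) inverse] colourings_eq_arc_colourings[OF m'_def] by simp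
  ultimately show ?thesis by simp
qed

end
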